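(* Let $\mu>0$ and $\varepsilon>0$ be real. The Laplace transform of the scaled full avalanche length for the simple symmetric random walk satisfies, for every $\lambda\ge0$, $$\lim_{n\to\infty} E\left[e^{-\frac{\lambda}{n}L^*_{\lfloor\mu \sqrt{n}\rfloor,\lfloor\varepsilon n\rfloor}}\right]= \frac{\int_{\varepsilon}^{\infty}h(x)\,dx}{\int_{0}^{\varepsilon}(1-e^{-\lambda x})h(x)\,dx+\int_{\varepsilon}^{\infty}h(x)\,dx},$$ where, for $x>0$, $$h(x)=\frac{1}{\sqrt{2\pi}} x^{-3/2}+2\sum_{k\geq1}(-1)^k\left[\frac{1}{\sqrt{2\pi}} x^{-3/2}-2\sqrt{\frac{2}{\pi}}\,k^{2}\mu^{2} x^{-5/2}\right]\exp\left(-\frac{2k^{2}\mu^{2}}{x}\right).$$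
   Context: $(S_n)_{n\ge0}$ is a simple symmetric random walk on $\mathbb{Z}$ with $S_0=0$. For an integer $m\ge1$, the order volume process $V(n,u)$, $n\ge0$, $u\in\mathbb{Z}$, with spread parameter $m$ is defined by $V(0,u)=I_{u\ge0}$ and, for $n\ge1$, $V(n,u)=0$ if $u=S_{n-1}$, $V(n,u)=V(n-1,u)+1$ if $u=S_{n-1}+m$, and $V(n,u)=V(n-1,u)$ otherwise. Trading times: $\tau_0=0$, $\tau_i=\inf\{n>\tau_{i-1}:V(n,S_n)>0\}$; intertrading times: $T_i=\tau_i-\tau_{i-1}$, $i\ge1$. For $w\ge0$, the full avalanche length $L^*_{m,w}$ with spread parameter $m$ and window parameter $w$ is defined by: if $k\ge0$ and $T_1\le w,\ldots,T_k\le w$, $T_{k+1}>w$, then $L^*_{m,w}=T_1+\cdots+T_k$ (so it equals $0$ if $T_1>w$). In the limit, $n$ is taken large enough that $\lfloor\mu\sqrt n\rfloor\ge1$. *)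

theory Defs
  imports "HOL-Probability.Probability" "HOL-Library.Extended_Nat"
begin

locale simple_symmetric_random_walk = prob_space M
  for M :: "'a measure" +
  fixes S :: "nat \<Rightarrow> 'a \<Rightarrow> int"
  assumes start: "\<omega> \<in> space M \<Longrightarrow> S 0 \<omega> = 0"
    and indep_increments:
      "indep_vars (\<lambda>_. count_space UNIV) (\<lambda>i \<omega>. S (Suc i) \<omega> - S i \<omega>) (UNIV :: nat set)"
    and increment_distr:
      "distr M (count_space UNIV) (\<lambda>\<omega>. S (Suc i) \<omega> - S i \<omega>) = measure_pmf (pmf_of_set {-1, 1})"

text \<open>The order book is a deterministic functional of the price path \<open>s\<close>, so the
  definitions below are pathwise.\<close>

primrec order_volume :: "nat \<Rightarrow> (nat \<Rightarrow> int) \<Rightarrow> nat \<Rightarrow> int \<Rightarrow> nat" where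
  "order_volume m s 0 u = (if u \<ge> 0 then 1 else 0)"
| "order_volume m s (Suc n) u =
    (if u = s n then 0
     else if u = s n + int m then order_volume m s n u + 1
     else order_volume m s n u)"

text \<open>The infimum is taken in \<^typ>\<open>enat\<close>, hence is \<open>\<infinity>\<close> if no further trade occurs.\<close>

primrec trading_time :: "nat \<Rightarrow> (nat \<Rightarrow> int) \<Rightarrow> nat \<Rightarrow> enat" where
  "trading_time m s 0 = 0"
| "trading_time m s (Suc i) =
    Inf {enat n | n. trading_time m s i < enat n \<and> order_volume m s n (s n) > 0}"

text \<open>Only used for \<open>i \<ge> 1\<close>. In \<^typ>\<open>enat\<close>, \<open>\<infinity> - x = \<infinity>\<close> for every \<open>x\<close>.\<close>

definition intertrading_time :: "nat \<Rightarrow> (nat \<Rightarrow> int) \<Rightarrow> nat \<Rightarrow> enat" where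
  "intertrading_time m s i = trading_time m s i - trading_time m s (i - 1)"

text \<open>The index \<open>k\<close> with \<open>T\<^sub>1 \<le> w, \<dots>, T\<^sub>k \<le> w\<close> and \<open>T\<^sub>k\<^sub>+\<^sub>1 > w\<close> is the
  least \<open>k\<close> with \<open>T\<^sub>k\<^sub>+\<^sub>1 > w\<close>, and \<open>T\<^sub>1, \<dots>, T\<^sub>k\<close> are then finite. On paths without such
  a \<open>k\<close>, which for \<open>m \<ge> 1\<close> form a null event for the random walk, the value is set to \<open>0\<close>.\<close>

definition full_avalanche_length :: "nat \<Rightarrow> nat \<Rightarrow> (nat \<Rightarrow> int) \<Rightarrow> nat" where
  "full_avalanche_length m w s =
    (if \<exists>k. intertrading_time m s (Suc k) > enat w
     then the_enat (\<Sum>i = 1..(LEAST k. intertrading_time m s (Suc k) > enat w).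
            intertrading_time m s i)
     else 0)"

text \<open>The sum over \<open>k \<ge> 1\<close> is indexed by \<open>k = Suc j\<close>. Only \<open>x > 0\<close> is relevant.\<close>

definition avalanche_h :: "real \<Rightarrow> real \<Rightarrow> real" where
  "avalanche_h \<mu> x =
    1 / sqrt (2 * pi) * x powr (-3/2)
    + 2 * (\<Sum>j. let k = Suc j in
        (-1) ^ k
        * (1 / sqrt (2 * pi) * x powr (-3/2)
           - 2 * sqrt (2 / pi) * (real k)\<^sup>2 * \<mu>\<^sup>2 * x powr (-5/2))
        * exp (- (2 * (real k)\<^sup>2 * \<mu>\<^sup>2 / x)))"

end

theory Submission imports Defs "HOL-Real_Asymp.Real_Asymp"
begin

text \<open>
  Let \<open>d\<close> be the distance from the price to the lowest occupied level of the book. It is a reflected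
  walk on \<open>{0..m+1}\<close> whose zeros are the trading times, and unfolding the reflection turns the
  intertrading time into the exit time of a simple random walk from \<open>(0, 2m+1)\<close> started at \<open>1\<close>.
  Write \<open>f n = P (T > n)\<close>. Independence of the intertrading times gives
  \<open>E (exp (- \<theta> L)) = f w / (1 - (\<Sum>i=1..w. exp (- \<theta> i) * P (T = i)))\<close>, and by summation by parts
  the denominator is \<open>f w + \<integral>\<^sub>0\<^sup>w \<theta> * exp (- \<theta> s) * (f \<lfloor>s\<rfloor> - f w) ds\<close>.

  By the method of images \<open>f n\<close> is an alternating sum of binomial probabilities that decrease with the
  image index. Hence a pointwise local limit theorem suffices to show that \<open>sqrt n * f (n s)\<close> tends to
  a theta series \<open>H s\<close>, for which \<open>H' = - h\<close>, while \<open>sqrt n * f (n s) \<le> 1 / sqrt s\<close> permits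
  dominated convergence. Monotonicity of \<open>H\<close> yields \<open>h \<ge> 0\<close>, and the eigenfunction
  \<open>sin (\<pi> x / (2m+1))\<close> yields \<open>H > 0\<close>.
\<close>

text \<open>Numerator and denominator of the renewal formula both vanish like
  \<open>1 / sqrt n\<close>, because after a trade the gap restarts next to the absorbing level;
  they are compared after multiplication by \<open>sqrt n\<close>. Working with
  \<open>P (T = i)\<close> directly would call for a finer local limit theorem and lead to
  \<open>h\<close>, which is not integrable at 0. Summation by parts leaves only the tail
  \<open>f\<close>, whose limit is of order \<open>x powr (-1/2)\<close> there. The interval
  \<open>(0, 2m+1)\<close> arises because the gaps \<open>m\<close> and \<open>m+1\<close> have the
  same future, which is the symmetry of a walk about \<open>m + 1/2\<close>. Starting at 1 makes
  \<open>f\<close> a local quantity: by oddness \<open>surv N n 1\<close> is half the difference of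
  \<open>surv N n\<close> across 0, and the differenced square wave consists of spikes of
  alternating sign at the multiples of \<open>N\<close>. Each spike spreads as one binomial weight.
  Positivity of the theta series at \<epsilon> keeps the limiting denominator away from 0, also for
  \<open>lam = 0\<close>. It cannot be read off from the alternating form, hence the
  eigenfunction.\<close>

section \<open>Binomial weights\<close>

text \<open>For a simple random walk \<open>W\<close> from \<open>0\<close> this is \<open>P (W n = x) + P (W (n+1) = x)\<close>, where one of
  the summands vanishes by parity. Unlike \<open>P (W n = x)\<close> alone, it is decreasing in \<open>x\<close>.\<close>

definition binw :: "nat \<Rightarrow> nat \<Rightarrow> real" where
  "binw n x = (let j = (n + x + 1) div 2; l = 2 * j - x in real (l choose j) / 2 ^ l)"

lemma binw_even: "even (n + x) \<Longrightarrow> binw n x = real (n choose ((n + x) div 2)) / 2 ^ n"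
  by (auto simp: binw_def Let_def elim!: evenE)

lemma binw_odd: "odd (n + x) \<Longrightarrow> binw n x = binw (Suc n) x"
  by (auto simp: binw_def Let_def elim!: oddE)

lemma binw_nonneg: "0 \<le> binw n x"
  by (simp add: binw_def Let_def)

lemma binw_eq_0:
  assumes "x > n + 1" shows "binw n x = 0"
proof -
  have *: "binw n x = 0" if "x > n" "even (n + x)" for n x
    using that by (simp add: binw_even) presburger
  show ?thesis
    using assms *[of n x] *[of "Suc n" x] binw_odd[of n x] by fastforce
qed

text \<open>Pascal's rule if \<open>n + x\<close> is even; for odd parity \<open>binw_odd\<close>
  moves every term to the next time. The weights thus obey the same averaging recursion as
  \<open>surv\<close>, which is what the images need.\<close>

lemma binw_Suc_Suc: "binw (Suc n) (Suc x) = (binw n x + binw n (Suc (Suc x))) / 2"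
proof -
  have *: "binw (Suc n) (Suc x) = (binw n x + binw n (Suc (Suc x))) / 2" if "even (n + x)" for n x
  proof -
    define j where "j = (n + x) div 2"
    have "(Suc n + Suc x) div 2 = Suc j" "(n + Suc (Suc x)) div 2 = Suc j"
      by (simp_all add: j_def)
    then show ?thesis using that by (simp add: binw_even j_def[symmetric] field_simps)
  qed
  show ?thesis
  proof (cases "even (n + x)")
    case False
    then show ?thesis using *[of "Suc n" x] binw_odd[of n x] binw_odd[of n "Suc (Suc x)"]
      binw_odd[of "Suc n" "Suc x"] by simp
  qed (use * in blast)
qed

text \<open>The averaging rule at the origin, both of whose neighbours have absolute value 1. It
  rests on the equality of the two middle binomials in an odd row.\<close>

lemma binw_Suc_0: "binw (Suc n) 0 = binw n 1"
proof -
  have *: "binw (Suc n) 0 = binw n 1" if n: "odd n" for n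
  proof -
    obtain k where k: "n = 2 * k + 1" using n by (elim oddE)
    have "binw (Suc n) 0 = real (2 * Suc k choose Suc k) / 2 ^ (2 * Suc k)"
      using binw_even[of "2 * Suc k" 0] by (simp add: k)
    moreover have "binw n 1 = real ((2 * k + 1) choose Suc k) / 2 ^ (2 * k + 1)"
      using binw_even[of "2 * k + 1" 1] by (simp add: k)
    moreover have "(2 * Suc k choose Suc k) = ((2 * k + 1) choose k) + ((2 * k + 1) choose Suc k)"
      using binomial_Suc_Suc[of "2 * k + 1" k] by (simp del: binomial_Suc_Suc)
    moreover have "((2 * k + 1) choose k) = ((2 * k + 1) choose Suc k)"
      using binomial_symmetric[of k "2 * k + 1"] by simp
    ultimately show ?thesis by (simp del: binomial_Suc_Suc)
  qed
  show ?thesis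
  proof (cases "odd n")
    case False
    then show ?thesis using *[of "Suc n"] binw_odd[of "Suc n" 0] binw_odd[of n 1] by simp
  qed (use * in blast)
qed

text \<open>The quotient of consecutive weights is \<open>(n + 1) / (2 * (j + 1))\<close> or
  \<open>2 * (n + 1 - i) / (n + 1)\<close>, according to parity. Both are at most 1 because
  \<open>x >= 0\<close> puts \<open>j\<close> and \<open>i\<close> in the upper half of the
  row.\<close>

lemma binw_Suc_le: "binw n (Suc x) \<le> binw n x"
proof (cases "even (n + x)")
  case True
  define j where "j = (n + x) div 2"
  have a: "binw n x = real (n choose j) / 2 ^ n" using True by (simp add: binw_even j_def)
  have "binw n (Suc x) = binw (Suc n) (Suc x)" using True by (intro binw_odd) simp
  also have "\<dots> = real (Suc n choose Suc j) / 2 ^ Suc n"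
    using True by (subst binw_even) (auto simp: j_def)
  also have "\<dots> \<le> real (n choose j) / 2 ^ n"
  proof -
    have "Suc n \<le> 2 * Suc j" using True by (auto simp: j_def elim!: evenE)
    then have "Suc n * (n choose j) \<le> 2 * Suc j * (n choose j)" by (intro mult_right_mono) auto
    then have "Suc j * (Suc n choose Suc j) \<le> Suc j * (2 * (n choose j))"
      using Suc_times_binomial_eq[of n j] by (simp only: mult_ac)
    then have "(Suc n choose Suc j) \<le> 2 * (n choose j)" by (simp only: Suc_mult_le_cancel1)
    then have "real (Suc n choose Suc j) \<le> 2 * real (n choose j)"
      by (metis of_nat_le_iff of_nat_mult of_nat_numeral)
    then show ?thesis by (simp add: field_simps)
  qed
  finally show ?thesis by (simp add: a)
next
  case False
  define i where "i = (Suc n + x) div 2"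
  have a: "binw n x = real (Suc n choose i) / 2 ^ Suc n"
    using False by (simp add: binw_odd binw_even i_def)
  have "binw n (Suc x) = real (n choose i) / 2 ^ n"
    using False by (simp add: binw_even i_def)
  also have "\<dots> \<le> real (Suc n choose i) / 2 ^ Suc n"
  proof (cases "i \<le> n")
    case True
    have "2 * (Suc n - i) \<le> Suc n" using False by (auto simp: i_def elim!: oddE)
    then have "2 * (Suc n - i) * (Suc n choose i) \<le> Suc n * (Suc n choose i)"
      by (intro mult_right_mono) auto
    moreover have "(Suc n - i) * (Suc n choose i) = Suc n * (n choose i)"
      using binomial_absorb_comp[of "Suc n" i] by simp
    ultimately have "Suc n * (2 * (n choose i)) \<le> Suc n * (Suc n choose i)" by simp
    then have "2 * (n choose i) \<le> (Suc n choose i)" by (metis Suc_mult_le_cancel1)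
    then have "2 * real (n choose i) \<le> real (Suc n choose i)"
      by (metis of_nat_le_iff of_nat_mult of_nat_numeral)
    then show ?thesis by (simp add: field_simps)
  qed (simp add: binomial_eq_0 not_le)
  finally show ?thesis by (simp add: a)
qed

lemma binw_antimono: "x \<le> y \<Longrightarrow> binw n y \<le> binw n x"
  by (rule lift_Suc_antimono_le[of "binw n"]) (auto simp: binw_Suc_le)

section \<open>Local limit theorem\<close>

text \<open>The quotient of neighbouring binomials in row \<open>2 * n\<close>, cleared of
  denominators. For \<open>i >= n\<close> the truncated \<open>n - i\<close> is 0, in agreement with
  a vanishing left-hand side.\<close>

lemma binw_even_step:
  "binw (2 * n) (2 * Suc i) * (real n + real i + 1) = binw (2 * n) (2 * i) * real (n - i)"
proof -
  have "Suc (n + i) * (2 * n choose Suc (n + i)) = (2 * n - (n + i)) * (2 * n choose (n + i))"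
    using binomial_absorption[of "n + i" "2 * n"] binomial_absorb_comp[of "2 * n" "n + i"] by simp
  then have "Suc (n + i) * (2 * n choose Suc (n + i)) = (n - i) * (2 * n choose (n + i))"
    by (simp add: mult_2)
  then have "real (Suc (n + i)) * real (2 * n choose Suc (n + i)) = real (n - i) * real (2 * n choose (n + i))"
    by (metis of_nat_mult)
  then show ?thesis by (simp add: binw_even field_simps)
qed

definition wallis_factor :: "nat \<Rightarrow> real" where
  "wallis_factor k = (4 * real k ^ 2) / (4 * real k ^ 2 - 1)"

text \<open>An exact link to Wallis' product for \<open>pi / 2\<close>. It yields the asymptotics of
  the central weight and, as every factor is at least 1, also a bound valid for each
  \<open>n\<close>.\<close>

lemma binw_central_sq:
  "(binw (2 * n) 0)\<^sup>2 * (2 * real n + 1) = inverse (\<Prod>k=1..n. wallis_factor k)"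
proof (induction n)
  case 0
  show ?case by (simp add: binw_even)
next
  case (Suc n)
  have "binw (2 * n) 2 * (real n + 1) = binw (2 * n) 0 * real n"
    using binw_even_step[of n 0] by simp
  moreover have "binw (2 * Suc n) 0 = (binw (2 * n) 0 + binw (2 * n) 2) / 2"
    using binw_Suc_0[of "Suc (2 * n)"] binw_Suc_Suc[of "2 * n" 0] by (simp add: numeral_2_eq_2)
  ultimately have r: "binw (2 * Suc n) 0 = binw (2 * n) 0 * ((2 * real n + 1) / (2 * real n + 2))"
    by (simp add: field_simps)
  have t: "wallis_factor (Suc n) = (2 * real n + 2)\<^sup>2 / ((2 * real n + 1) * (2 * real n + 3))"
    by (simp add: wallis_factor_def algebra_simps power2_eq_square)
  have "2 * real n + 1 \<noteq> 0" "2 * real n + 3 \<noteq> 0" "2 * real n + 2 \<noteq> 0" by linarith+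
  then have "inverse (wallis_factor (Suc n)) * (2 * real n + 1)
     = ((2 * real n + 1) / (2 * real n + 2))\<^sup>2 * (2 * real n + 3)"
    unfolding t by (simp add: power2_eq_square)
  note * = this
  have "(binw (2 * Suc n) 0)\<^sup>2 * (2 * real (Suc n) + 1)
     = (binw (2 * n) 0)\<^sup>2 * (((2 * real n + 1) / (2 * real n + 2))\<^sup>2 * (2 * real n + 3))"
    unfolding r by (simp only: power_mult_distrib) (simp add: add_ac)
  also have "\<dots> = ((binw (2 * n) 0)\<^sup>2 * (2 * real n + 1)) * inverse (wallis_factor (Suc n))"
    by (subst *[symmetric]) (simp only: mult_ac)
  also have "\<dots> = inverse (\<Prod>k=1..Suc n. wallis_factor k)"
    unfolding Suc by simp
  finally show ?case .
qed

lemma binw_central_le: "binw n 0 \<le> 1 / sqrt (real n + 1)"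
proof -
  have *: "binw (2 * n) 0 \<le> 1 / sqrt (real (2 * n) + 1)" for n
  proof -
    have "(\<Prod>k=1..n. wallis_factor k) \<ge> 1"
    proof (rule prod_ge_1)
      fix k assume "k \<in> {1..n}"
      then have "1 \<le> real k ^ 2" by simp
      then show "1 \<le> wallis_factor k" by (simp add: wallis_factor_def field_simps)
    qed
    then have "(binw (2 * n) 0)\<^sup>2 * (2 * real n + 1) \<le> 1"
      unfolding binw_central_sq by (simp add: inverse_le_1_iff)
    then have "(binw (2 * n) 0)\<^sup>2 \<le> 1 / (2 * real n + 1)" by (simp add: field_simps)
    then have "sqrt ((binw (2 * n) 0)\<^sup>2) \<le> sqrt (1 / (2 * real n + 1))" by (rule real_sqrt_le_mono)
    then show ?thesis by (simp add: binw_nonneg real_sqrt_divide)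
  qed
  show ?thesis
  proof (cases "even n")
    case True
    then show ?thesis using *[of "n div 2"] by simp
  next
    case False
    then have "binw n 0 = binw (2 * (Suc n div 2)) 0" by (simp add: binw_odd)
    also have "\<dots> \<le> 1 / sqrt (real (2 * (Suc n div 2)) + 1)" by (rule *)
    also have "\<dots> \<le> 1 / sqrt (real n + 1)" using False
      by (intro divide_left_mono mult_pos_pos real_sqrt_le_mono) auto
    finally show ?thesis .
  qed
qed

text \<open>Each quotient is \<open>1 - (2 * l + 1) / (n + l + 1)\<close>, to which
  \<open>1 - y \<le> exp (- y)\<close> applies, and the odd numbers \<open>2 * l + 1\<close> for
  \<open>l < i\<close> add up to \<open>i\<^sup>2\<close>. Fixing \<open>J\<close> keeps the
  denominator constant during the induction.\<close>

lemma binw_even_upper: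
  assumes "i \<le> J"
  shows "binw (2 * n) (2 * i) \<le> binw (2 * n) 0 * exp (- (real i ^ 2 / (real n + real J)))"
  using assms
proof (induction i)
  case (Suc i)
  have "binw (2 * n) (2 * Suc i) = binw (2 * n) (2 * i) * (real (n - i) / (real n + real i + 1))"
    using binw_even_step[of n i] by (simp add: field_simps)
  also have "\<dots> \<le> (binw (2 * n) 0 * exp (- (real i ^ 2 / (real n + real J)))) *
      exp (- ((2 * real i + 1) / (real n + real J)))"
  proof (intro mult_mono)
    show "real (n - i) / (real n + real i + 1) \<le> exp (- ((2 * real i + 1) / (real n + real J)))"
    proof (cases "i \<le> n")
      case True
      have "(2 * real i + 1) / (real n + real J) \<le> (2 * real i + 1) / (real n + real i + 1)"
        using Suc.prems by (intro divide_left_mono) auto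
      moreover have "real (n - i) / (real n + real i + 1) = 1 - (2 * real i + 1) / (real n + real i + 1)"
        using True by (simp add: field_simps of_nat_diff)
      ultimately show ?thesis
        using exp_ge_add_one_self[of "- ((2 * real i + 1) / (real n + real J))"] by linarith
    qed simp
  qed (use Suc in \<open>auto simp: binw_nonneg\<close>)
  also have "\<dots> = binw (2 * n) 0 * exp (- (real (Suc i) ^ 2 / (real n + real J)))"
    by (simp add: exp_add[symmetric] add_divide_distrib[symmetric] power2_eq_square algebra_simps)
  finally show ?case .
qed simp

text \<open>The same argument with \<open>1 + y \<le> exp y\<close>, applied to the inverse
  quotients \<open>(n + l + 1) / (n - l)\<close>; \<open>J < n\<close> keeps their denominators
  positive.\<close>

lemma binw_even_lower:
  assumes "i \<le> J" "J < n"
  shows "binw (2 * n) 0 * exp (- (real i ^ 2 / (real n - real J))) \<le> binw (2 * n) (2 * i)"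
  using assms(1)
proof (induction i)
  case (Suc i)
  have "binw (2 * n) 0 * exp (- (real (Suc i) ^ 2 / (real n - real J)))
    = (binw (2 * n) 0 * exp (- (real i ^ 2 / (real n - real J)))) *
      exp (- ((2 * real i + 1) / (real n - real J)))"
    by (simp add: exp_add[symmetric] add_divide_distrib[symmetric] power2_eq_square algebra_simps)
  also have "\<dots> \<le> binw (2 * n) (2 * i) * (real (n - i) / (real n + real i + 1))"
  proof (intro mult_mono)
    have pos: "real n - real i > 0" using Suc.prems assms by auto
    have "(2 * real i + 1) / (real n - real i) \<le> (2 * real i + 1) / (real n - real J)"
      using Suc.prems assms by (intro divide_left_mono) auto
    moreover have "(real n + real i + 1) / (real n - real i) = 1 + (2 * real i + 1) / (real n - real i)"
      using pos by (simp add: field_simps)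
    ultimately have "(real n + real i + 1) / (real n - real i) \<le> exp ((2 * real i + 1) / (real n - real J))"
      using exp_ge_add_one_self[of "(2 * real i + 1) / (real n - real J)"] by linarith
    then have "inverse (exp ((2 * real i + 1) / (real n - real J))) \<le>
        inverse ((real n + real i + 1) / (real n - real i))"
      using pos by (intro le_imp_inverse_le divide_pos_pos) auto
    then show "exp (- ((2 * real i + 1) / (real n - real J))) \<le> real (n - i) / (real n + real i + 1)"
      using pos by (simp add: exp_minus of_nat_diff)
  qed (use Suc in \<open>auto simp: binw_nonneg\<close>)
  also have "\<dots> = binw (2 * n) (2 * Suc i)"
    using binw_even_step[of n i] by (simp add: field_simps)
  finally show ?case .
qed simp

lemma binw_central_tendsto:
  "(\<lambda>n. sqrt (2 * real n + 1) * binw (2 * n) 0) \<longlonglongrightarrow> sqrt (2 / pi)"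
proof -
  have "(\<lambda>n. sqrt (inverse (\<Prod>k=1..n. wallis_factor k))) \<longlonglongrightarrow> sqrt (inverse (pi / 2))"
    by (intro tendsto_real_sqrt tendsto_inverse wallis[folded wallis_factor_def]) simp
  moreover have "sqrt (inverse (\<Prod>k=1..n. wallis_factor k))
      = sqrt (2 * real n + 1) * binw (2 * n) 0" for n
    unfolding binw_central_sq[symmetric] by (simp add: real_sqrt_mult binw_nonneg)
  ultimately show ?thesis by (simp only: inverse_divide)
qed

lemma binw_even_tendsto:
  fixes n i :: "nat \<Rightarrow> nat"
  assumes n: "filterlim n at_top sequentially"
    and i: "(\<lambda>k. real (i k) / sqrt (real (n k))) \<longlonglongrightarrow> z"
  shows "(\<lambda>k. sqrt (2 * real (n k) + 1) * binw (2 * n k) (2 * i k)) \<longlonglongrightarrow> sqrt (2 / pi) * exp (- z\<^sup>2)"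
proof -
  \<comment> \<open>As \<open>i\<close> is of order \<open>sqrt n\<close>, the ratio
    \<open>i / n\<close> vanishes. The denominators \<open>n + i\<close> and \<open>n - i\<close> of
    the two exponential bounds, taken with \<open>J = i\<close>, are \<open>n * (1 + q)\<close> and
    \<open>n * (1 - q)\<close>.\<close>
  define q where "q = (\<lambda>k. real (i k) / real (n k))"
  have pos: "\<forall>\<^sub>F k in sequentially. 0 < n k"
    by (rule eventually_compose_filterlim[OF eventually_gt_at_top n])
  have rn: "filterlim (\<lambda>k. sqrt (real (n k))) at_top sequentially"
    by (intro filterlim_compose[OF sqrt_at_top] filterlim_compose[OF filterlim_real_sequentially] n)
  have "(\<lambda>k. real (i k) / sqrt (real (n k)) * inverse (sqrt (real (n k)))) \<longlonglongrightarrow> z * 0"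
    by (intro tendsto_mult i tendsto_inverse_0_at_top rn)
  then have q: "q \<longlonglongrightarrow> 0"
    by (auto simp: q_def field_simps real_sqrt_mult_self)
  have sq: "(\<lambda>k. (real (i k) / sqrt (real (n k)))\<^sup>2) \<longlonglongrightarrow> z\<^sup>2"
    by (intro tendsto_power i)
  define B where "B = (\<lambda>k. sqrt (2 * real (n k) + 1) * binw (2 * n k) 0)"
  have B: "B \<longlonglongrightarrow> sqrt (2 / pi)"
    unfolding B_def by (rule filterlim_compose[OF binw_central_tendsto n])
  have up: "(\<lambda>k. B k * exp (- ((real (i k) / sqrt (real (n k)))\<^sup>2 / (1 + q k)))) \<longlonglongrightarrow>
      sqrt (2 / pi) * exp (- (z\<^sup>2 / (1 + 0)))"
    by (intro tendsto_intros B sq q) auto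
  have low: "(\<lambda>k. B k * exp (- ((real (i k) / sqrt (real (n k)))\<^sup>2 / (1 - q k)))) \<longlonglongrightarrow>
      sqrt (2 / pi) * exp (- (z\<^sup>2 / (1 - 0)))"
    by (intro tendsto_intros B sq q) auto
  have lt: "\<forall>\<^sub>F k in sequentially. i k < n k"
    using order_tendstoD(2)[OF q zero_less_one] pos
    by eventually_elim (auto simp: q_def)
  show ?thesis
  proof (rule tendsto_sandwich)
    show "\<forall>\<^sub>F k in sequentially. B k * exp (- ((real (i k) / sqrt (real (n k)))\<^sup>2 / (1 - q k)))
      \<le> sqrt (2 * real (n k) + 1) * binw (2 * n k) (2 * i k)"
      using lt pos
    proof eventually_elim
      case (elim k)
      have e: "(real (i k) / sqrt (real (n k)))\<^sup>2 / (1 - q k) = real (i k) ^ 2 / (real (n k) - real (i k))"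
        using elim by (simp add: q_def power_divide field_simps)
      show ?case unfolding e B_def mult.assoc
        by (intro mult_left_mono binw_even_lower elim) auto
    qed
    show "\<forall>\<^sub>F k in sequentially. sqrt (2 * real (n k) + 1) * binw (2 * n k) (2 * i k)
      \<le> B k * exp (- ((real (i k) / sqrt (real (n k)))\<^sup>2 / (1 + q k)))"
      using pos
    proof eventually_elim
      case (elim k)
      have e: "(real (i k) / sqrt (real (n k)))\<^sup>2 / (1 + q k) = real (i k) ^ 2 / (real (n k) + real (i k))"
        using elim by (simp add: q_def power_divide field_simps)
      show ?case unfolding e B_def mult.assoc
        by (intro mult_left_mono binw_even_upper elim) auto
    qed
  qed (use up low in simp_all)
qed

text \<open>Together with the next lemma: one unit of time can be traded for one unit of distance.
  This is how odd times are compared with even ones.\<close>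

lemma binw_Suc_le_pred: "binw (Suc n) x \<le> binw n (x - 1)"
proof (cases x)
  case (Suc y)
  then show ?thesis using binw_Suc_Suc[of n y] binw_antimono[of y "Suc (Suc y)" n] by simp
qed (use binw_Suc_0[of n] binw_antimono[of 0 1 n] in simp)

lemma binw_Suc_ge_Suc: "binw n (Suc x) \<le> binw (Suc n) x"
proof (cases x)
  case (Suc y)
  then show ?thesis using binw_Suc_Suc[of n y] binw_antimono[of y "Suc (Suc y)" n] by simp
qed (use binw_Suc_0[of n] in simp)

text \<open>Odd times and positions are squeezed between even ones, since monotonicity allows the
  position to be moved by a bounded amount. With \<open>i\<close> near \<open>x / 2\<close> and
  \<open>n\<close> near \<open>l / 2\<close>, the ratio \<open>i / sqrt n\<close> tends to
  \<open>y / sqrt 2\<close>, whence the exponent \<open>- y\<^sup>2 / 2\<close>.\<close>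

lemma binw_tendsto:
  fixes l x :: "nat \<Rightarrow> nat"
  assumes l: "filterlim l at_top sequentially"
    and x: "(\<lambda>k. real (x k) / sqrt (real (l k))) \<longlonglongrightarrow> y"
  shows "(\<lambda>k. sqrt (real (l k)) * binw (l k) (x k)) \<longlonglongrightarrow> sqrt (2 / pi) * exp (- y\<^sup>2 / 2)"
proof -
  define n where "n = (\<lambda>k. l k div 2)"
  define b where "b = (\<lambda>k. real (l k mod 2))"
  have ln: "real (l k) = 2 * real (n k) + b k" for k
    unfolding n_def b_def by (metis mult_div_mod_eq of_nat_add of_nat_mult of_nat_numeral)
  have b: "0 \<le> b k" "b k \<le> 1" for k by (auto simp: b_def)
  have nlim: "filterlim n at_top sequentially"
    unfolding n_def by (rule filterlim_compose[OF _ l]) real_asymp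
  have rl: "filterlim (\<lambda>k. sqrt (real (l k))) at_top sequentially"
    by (intro filterlim_compose[OF sqrt_at_top] filterlim_compose[OF filterlim_real_sequentially] l)
  have rl': "filterlim (\<lambda>k. real (l k)) at_top sequentially"
    by (intro filterlim_compose[OF filterlim_real_sequentially] l)
  have lpos: "\<forall>\<^sub>F k in sequentially. 1 < l k"
    by (rule eventually_compose_filterlim[OF eventually_gt_at_top l])
  have bl: "(\<lambda>k. b k / real (l k)) \<longlonglongrightarrow> 0"
  proof (rule tendsto_sandwich[where f = "\<lambda>_. 0"])
    show "(\<lambda>k. 1 / real (l k)) \<longlonglongrightarrow> 0"
      by (rule tendsto_divide_0[OF tendsto_const filterlim_at_top_imp_at_infinity[OF rl']])
    show "\<forall>\<^sub>F k in sequentially. b k / real (l k) \<le> 1 / real (l k)"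
      by (intro always_eventually allI divide_right_mono b) simp
    show "\<forall>\<^sub>F k in sequentially. 0 \<le> b k / real (l k)"
      by (intro always_eventually allI divide_nonneg_nonneg b) simp
  qed simp
  have r1: "(\<lambda>k. sqrt (real (l k)) / sqrt (2 * real (n k) + 1)) \<longlonglongrightarrow> 1"
  proof -
    have "(\<lambda>k. sqrt (1 / (1 - b k / real (l k) + 1 / real (l k)))) \<longlonglongrightarrow> sqrt (1 / (1 - 0 + 0))"
      by (intro tendsto_intros bl tendsto_divide_0[OF tendsto_const filterlim_at_top_imp_at_infinity[OF rl']]) auto
    moreover have "\<forall>\<^sub>F k in sequentially. sqrt (1 / (1 - b k / real (l k) + 1 / real (l k)))
        = sqrt (real (l k)) / sqrt (2 * real (n k) + 1)"
      using lpos
    proof eventually_elim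
      case (elim k)
      then have "2 * real (n k) + 1 = real (l k) * (1 - b k / real (l k) + 1 / real (l k))"
        using ln[of k] by (simp add: field_simps)
      then show ?case using elim by (simp add: real_sqrt_divide real_sqrt_mult)
    qed
    ultimately show ?thesis by (simp add: tendsto_cong)
  qed
  have r2: "(\<lambda>k. sqrt (real (l k)) / sqrt (real (n k))) \<longlonglongrightarrow> sqrt 2"
  proof -
    have "(\<lambda>k. sqrt (2 / (1 - b k / real (l k)))) \<longlonglongrightarrow> sqrt (2 / (1 - 0))"
      by (intro tendsto_intros bl) auto
    moreover have "\<forall>\<^sub>F k in sequentially. sqrt (2 / (1 - b k / real (l k)))
        = sqrt (real (l k)) / sqrt (real (n k))"
      using lpos
    proof eventually_elim
      case (elim k)
      then have "2 * real (n k) = real (l k) * (1 - b k / real (l k))"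
        using ln[of k] by (simp add: field_simps)
      then have "2 / (1 - b k / real (l k)) = real (l k) / real (n k)"
        using elim ln[of k] b[of k] by (simp add: field_simps)
      then show ?case by (simp add: real_sqrt_divide)
    qed
    ultimately show ?thesis by (simp add: tendsto_cong)
  qed
  have il: "(\<lambda>k. 1 / sqrt (real (l k))) \<longlonglongrightarrow> 0"
    by (rule tendsto_divide_0[OF tendsto_const filterlim_at_top_imp_at_infinity[OF rl]])
  \<comment> \<open>The slack 2 covers both roundings used below, \<open>x div 2 + 1\<close> and the
    truncated \<open>x div 2 - 1\<close>.\<close>
  have shift: "(\<lambda>k. real (i k) / sqrt (real (n k))) \<longlonglongrightarrow> y / 2 * sqrt 2"
    if i: "\<And>k. real (x k) / 2 - 2 \<le> real (i k)" "\<And>k. real (i k) \<le> real (x k) / 2 + 2" for i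
  proof -
    have "(\<lambda>k. real (i k) / sqrt (real (l k))) \<longlonglongrightarrow> y / 2"
    proof (rule tendsto_sandwich)
      show "(\<lambda>k. real (x k) / sqrt (real (l k)) / 2 - 2 * (1 / sqrt (real (l k)))) \<longlonglongrightarrow> y / 2"
        by (rule tendsto_eq_intros x il refl | simp)+
      show "(\<lambda>k. real (x k) / sqrt (real (l k)) / 2 + 2 * (1 / sqrt (real (l k)))) \<longlonglongrightarrow> y / 2"
        by (rule tendsto_eq_intros x il refl | simp)+
      show "\<forall>\<^sub>F k in sequentially. real (x k) / sqrt (real (l k)) / 2 - 2 * (1 / sqrt (real (l k)))
          \<le> real (i k) / sqrt (real (l k))" using lpos
      proof eventually_elim
        case (elim k)
        have "(real (x k) / 2 - 2) / sqrt (real (l k)) \<le> real (i k) / sqrt (real (l k))"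
          by (intro divide_right_mono i) auto
        then show ?case by (simp add: diff_divide_distrib)
      qed
      show "\<forall>\<^sub>F k in sequentially. real (i k) / sqrt (real (l k))
          \<le> real (x k) / sqrt (real (l k)) / 2 + 2 * (1 / sqrt (real (l k)))" using lpos
      proof eventually_elim
        case (elim k)
        have "real (i k) / sqrt (real (l k)) \<le> (real (x k) / 2 + 2) / sqrt (real (l k))"
          by (intro divide_right_mono i) auto
        then show ?case by (simp add: add_divide_distrib)
      qed
    qed
    then have "(\<lambda>k. real (i k) / sqrt (real (l k)) * (sqrt (real (l k)) / sqrt (real (n k)))) \<longlonglongrightarrow> y / 2 * sqrt 2"
      by (intro tendsto_mult r2)
    moreover have "\<forall>\<^sub>F k in sequentially. real (i k) / sqrt (real (l k)) * (sqrt (real (l k)) / sqrt (real (n k)))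
        = real (i k) / sqrt (real (n k))"
      using lpos by eventually_elim simp
    ultimately show ?thesis by (rule Lim_transform_eventually)
  qed
  have lim: "(\<lambda>k. sqrt (real (l k)) * binw (2 * n k) (2 * i k)) \<longlonglongrightarrow> sqrt (2 / pi) * exp (- y\<^sup>2 / 2)"
    if i: "\<And>k. real (x k) / 2 - 2 \<le> real (i k)" "\<And>k. real (i k) \<le> real (x k) / 2 + 2" for i
  proof -
    have "(\<lambda>k. sqrt (real (l k)) / sqrt (2 * real (n k) + 1) *
        (sqrt (2 * real (n k) + 1) * binw (2 * n k) (2 * i k))) \<longlonglongrightarrow>
        1 * (sqrt (2 / pi) * exp (- (y / 2 * sqrt 2)\<^sup>2))"
      by (intro tendsto_mult r1 binw_even_tendsto nlim shift i)
    moreover have "sqrt (real (l k)) / sqrt (2 * real (n k) + 1) *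
        (sqrt (2 * real (n k) + 1) * binw (2 * n k) (2 * i k)) = sqrt (real (l k)) * binw (2 * n k) (2 * i k)" for k
    proof -
      have "sqrt (2 * real (n k) + 1) > 0" by simp
      then show ?thesis by (simp add: field_simps)
    qed
    ultimately show ?thesis by (simp add: power_mult_distrib power_divide)
  qed
  show ?thesis
  proof (rule tendsto_sandwich)
    show "(\<lambda>k. sqrt (real (l k)) * binw (2 * n k) (2 * (x k div 2 + 1))) \<longlonglongrightarrow> sqrt (2 / pi) * exp (- y\<^sup>2 / 2)"
      by (rule lim) linarith+
    show "(\<lambda>k. sqrt (real (l k)) * binw (2 * n k) (2 * (x k div 2 - 1))) \<longlonglongrightarrow> sqrt (2 / pi) * exp (- y\<^sup>2 / 2)"
      by (rule lim) linarith+
    have l_cases: "l k = 2 * n k \<or> l k = Suc (2 * n k)" for k by (auto simp: n_def)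
    have "binw (2 * n k) (2 * (x k div 2 + 1)) \<le> binw (l k) (x k)" for k
    proof -
      have "binw (2 * n k) (2 * (x k div 2 + 1)) \<le> binw (2 * n k) (Suc (x k))"
        by (rule binw_antimono) simp
      also have "\<dots> \<le> binw (l k) (x k)"
        using l_cases[of k] binw_Suc_ge_Suc[of "2 * n k" "x k"] binw_Suc_le[of "2 * n k" "x k"] by auto
      finally show ?thesis .
    qed
    then show "\<forall>\<^sub>F k in sequentially. sqrt (real (l k)) * binw (2 * n k) (2 * (x k div 2 + 1))
        \<le> sqrt (real (l k)) * binw (l k) (x k)"
      by (intro always_eventually allI mult_left_mono) auto
    have "binw (l k) (x k) \<le> binw (2 * n k) (2 * (x k div 2 - 1))" for k
    proof -
      have "binw (l k) (x k) \<le> binw (2 * n k) (x k - 1)"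
        using l_cases[of k] binw_Suc_le_pred[of "2 * n k" "x k"] binw_antimono[of "x k - 1" "x k" "2 * n k"] by auto
      also have "\<dots> \<le> binw (2 * n k) (2 * (x k div 2 - 1))"
        by (rule binw_antimono) simp
      finally show ?thesis .
    qed
    then show "\<forall>\<^sub>F k in sequentially. sqrt (real (l k)) * binw (l k) (x k)
        \<le> sqrt (real (l k)) * binw (2 * n k) (2 * (x k div 2 - 1))"
      by (intro always_eventually allI mult_left_mono) auto
  qed
qed

text \<open>Even and odd partial sums bracket an alternating series with decreasing terms. Both sums
  are therefore known up to their term of index \<open>2 * J\<close>, and these tend to
  \<open>b (2 * J)\<close>, which is small; finitely many termwise limits do the rest.\<close>

lemma alternating_suminf_tendsto:
  fixes a :: "nat \<Rightarrow> nat \<Rightarrow> real" and b :: "nat \<Rightarrow> real"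
  assumes a0: "\<And>n. a n \<longlonglongrightarrow> 0" and ann: "\<And>n j. 0 \<le> a n j" and adec: "\<And>n j. a n (Suc j) \<le> a n j"
    and b0: "b \<longlonglongrightarrow> 0" and lim: "\<And>j. (\<lambda>n. a n j) \<longlonglongrightarrow> b j"
  shows "(\<lambda>n. \<Sum>j. (-1) ^ j * a n j) \<longlonglongrightarrow> (\<Sum>j. (-1) ^ j * b j)"
proof (rule LIMSEQ_I)
  fix r :: real assume r: "r > 0"
  have bnn: "0 \<le> b j" for j by (rule LIMSEQ_le_const[OF lim]) (auto simp: ann)
  have bdec: "b (Suc j) \<le> b j" for j by (rule LIMSEQ_le[OF lim lim]) (auto simp: adec)
  have A: "(\<Sum>i<2*J. (-1) ^ i * a n i) \<le> (\<Sum>j. (-1) ^ j * a n j)"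
    "(\<Sum>j. (-1) ^ j * a n j) \<le> (\<Sum>i<2*J+1. (-1) ^ i * a n i)" for n J
    by (rule summable_Leibniz'(2,4)[of "a n"]; fact a0 ann adec)+
  have B: "(\<Sum>i<2*J. (-1) ^ i * b i) \<le> (\<Sum>j. (-1) ^ j * b j)"
    "(\<Sum>j. (-1) ^ j * b j) \<le> (\<Sum>i<2*J+1. (-1) ^ i * b i)" for J
    by (rule summable_Leibniz'(2,4)[of b]; fact b0 bnn bdec)+
  obtain J where J: "\<And>k. k \<ge> J \<Longrightarrow> norm (b k - 0) < r / 4" using LIMSEQ_D[OF b0, of "r / 4"] r by auto
  have bJ: "b (2 * J) < r / 4" using J[of "2 * J"] by auto
  have "(\<lambda>n. \<Sum>j<2*J. (-1) ^ j * a n j) \<longlonglongrightarrow> (\<Sum>j<2*J. (-1) ^ j * b j)"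
    by (intro tendsto_intros lim)
  from LIMSEQ_D[OF this, of "r / 4"] r obtain N1 where
    N1: "\<And>n. n \<ge> N1 \<Longrightarrow> norm ((\<Sum>j<2*J. (-1) ^ j * a n j) - (\<Sum>j<2*J. (-1) ^ j * b j)) < r / 4" by auto
  from LIMSEQ_D[OF lim[of "2 * J"], of "r / 4"] r obtain N2 where
    N2: "\<And>n. n \<ge> N2 \<Longrightarrow> norm (a n (2 * J) - b (2 * J)) < r / 4" by auto
  show "\<exists>N. \<forall>n\<ge>N. norm ((\<Sum>j. (-1) ^ j * a n j) - (\<Sum>j. (-1) ^ j * b j)) < r"
  proof (intro exI allI impI)
    fix n assume n: "n \<ge> max N1 N2"
    show "norm ((\<Sum>j. (-1) ^ j * a n j) - (\<Sum>j. (-1) ^ j * b j)) < r"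
      using N1[of n] N2[of n] n bJ A[of n J] B[of J] by (simp add: abs_real_def split: if_splits)
  qed
qed

section \<open>Method of images\<close>

text \<open>The square wave is odd and changes sign under translation by \<open>N\<close>, and averaging preserves
  both symmetries. Hence for \<open>0 < x < N\<close> the average \<open>surv N n x\<close> is the probability that a simple
  random walk from \<open>x\<close> stays inside \<open>(0, N)\<close> up to time \<open>n\<close>.\<close>

definition wave :: "int \<Rightarrow> int \<Rightarrow> real" where
  "wave N x = (if N dvd x then 0 else if even (x div N) then 1 else -1)"

primrec surv :: "int \<Rightarrow> nat \<Rightarrow> int \<Rightarrow> real" where
  "surv N 0 x = wave N x"
| "surv N (Suc n) x = (surv N n (x - 1) + surv N n (x + 1)) / 2"

lemma wave_add: "N > 0 \<Longrightarrow> wave N (x + N) = - wave N x"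
  by (simp add: wave_def)

lemma wave_uminus: "N > 0 \<Longrightarrow> wave N (- x) = - wave N x"
  by (cases "N dvd x") (simp_all add: wave_def zdiv_zminus1_eq_if mod_eq_0_iff_dvd)

lemma wave_shift_nat: "N > 0 \<Longrightarrow> wave N (int k * N + x) = (-1) ^ k * wave N x"
proof (induction k)
  case (Suc k)
  then show ?case using wave_add[of N "int k * N + x"] by (simp add: algebra_simps)
qed simp

lemma wave_shift:
  assumes "N > 0" shows "wave N (k * N + x) = (-1) ^ nat \<bar>k\<bar> * wave N x"
proof (cases "k \<ge> 0")
  case True
  then show ?thesis using wave_shift_nat[OF assms, of "nat k" x] by simp
next
  case False
  have "wave N (int (nat (- k)) * N + (- x)) = (-1) ^ nat (- k) * wave N (- x)"
    by (rule wave_shift_nat[OF assms])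
  also have "int (nat (- k)) * N + (- x) = - (k * N + x)" using False by simp
  finally show ?thesis using False assms wave_uminus[of N "k * N + x"] wave_uminus[of N x] by simp
qed

lemma wave_small: "0 < x \<Longrightarrow> x < N \<Longrightarrow> wave N x = 1"
  by (auto simp: wave_def dest: zdvd_imp_le)

lemma wave_0: "wave N 0 = 0"
  by (simp add: wave_def)

lemma surv_uminus: "N > 0 \<Longrightarrow> surv N n (- x) = - surv N n x"
proof (induction n arbitrary: x)
  case (Suc n)
  have "surv N n (- x - 1) = - surv N n (x + 1)" "surv N n (- x + 1) = - surv N n (x - 1)"
    using Suc.IH[OF Suc.prems, of "x + 1"] Suc.IH[OF Suc.prems, of "x - 1"] by simp_all
  then show ?case by (simp add: field_simps)
qed (simp add: wave_uminus)

lemma surv_add: "N > 0 \<Longrightarrow> surv N n (x + N) = - surv N n x"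
proof (induction n arbitrary: x)
  case (Suc n)
  have "surv N n (x + N - 1) = - surv N n (x - 1)" "surv N n (x + N + 1) = - surv N n (x + 1)"
    using Suc.IH[OF Suc.prems, of "x + 1"] Suc.IH[OF Suc.prems, of "x - 1"] by (simp_all add: algebra_simps)
  then show ?case by (simp add: field_simps)
qed (simp add: wave_add)

lemma surv_reflect: "N > 0 \<Longrightarrow> surv N n (N - x) = surv N n x"
  using surv_add[of N n "- x"] surv_uminus[of N n x] by simp

lemma surv_zero: "N > 0 \<Longrightarrow> surv N n 0 = 0"
  using surv_uminus[of N n 0] by simp

section \<open>Image sums of binomial weights\<close>

lemma binw_abs_Suc:
  "binw (Suc n) (nat \<bar>x\<bar>) = (binw n (nat \<bar>x - 1\<bar>) + binw n (nat \<bar>x + 1\<bar>)) / 2" for x :: int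
proof -
  have *: "binw (Suc n) (nat \<bar>x\<bar>) = (binw n (nat \<bar>x - 1\<bar>) + binw n (nat \<bar>x + 1\<bar>)) / 2" if x: "x > 0" for x
  proof -
    have "nat \<bar>x\<bar> = Suc (nat \<bar>x - 1\<bar>)" "nat \<bar>x + 1\<bar> = Suc (Suc (nat \<bar>x - 1\<bar>))" using x by auto
    then show ?thesis by (simp only: binw_Suc_Suc)
  qed
  consider "x > 0" | "x = 0" | "- x > 0" by linarith
  then show ?thesis
  proof cases
    case 3
    have "\<bar>- x - 1\<bar> = \<bar>x + 1\<bar>" "\<bar>- x + 1\<bar> = \<bar>x - 1\<bar>" by auto
    then show ?thesis using *[OF 3] by (simp add: add.commute)
  qed (use * binw_Suc_0[of n] in simp_all)
qed

lemma binw_zero: "binw 0 x = (if x = 0 then 1 else if x = 1 then 1 / 2 else 0)"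
proof -
  have "binw 0 0 = 1" by (simp add: binw_even)
  moreover have "binw 0 1 = 1 / 2" by (simp add: binw_odd binw_even)
  ultimately show ?thesis using binw_eq_0[of 0 x] by auto
qed

text \<open>The wave jumps by 2 at each multiple \<open>k * N\<close>, upwards for even
  \<open>k\<close> and downwards for odd \<open>k\<close>, and is 0 at the multiple itself. Its
  halved central difference is thus 1 at distance 0 and 1/2 at distance 1, which are the values of
  \<open>binw 0\<close>. \<open>N >= 3\<close> keeps the spikes apart.\<close>

lemma wave_difference:
  assumes N: "N \<ge> 3" and K: "\<bar>x\<bar> + 1 \<le> K * N"
  shows "(wave N (x + 1) - wave N (x - 1)) / 2 = (\<Sum>k\<in>{-K..K}. (-1) ^ nat \<bar>k\<bar> * binw 0 (nat \<bar>x - k * N\<bar>))"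
proof (cases "\<exists>k d. x = k * N + d \<and> \<bar>d\<bar> \<le> 1")
  case True
  then obtain k0 d where kd: "x = k0 * N + d" "\<bar>d\<bar> \<le> 1" by blast
  have "\<bar>k0 * N\<bar> \<le> K * N" using kd K by linarith
  then have "\<bar>k0\<bar> * N \<le> K * N" using N by (simp add: abs_mult)
  then have "\<bar>k0\<bar> \<le> K" using N by simp
  then have k0: "k0 \<in> {-K..K}" by auto
  have "(\<Sum>k\<in>{-K..K}. (-1) ^ nat \<bar>k\<bar> * binw 0 (nat \<bar>x - k * N\<bar>))
     = (\<Sum>k\<in>{k0}. (-1) ^ nat \<bar>k\<bar> * binw 0 (nat \<bar>x - k * N\<bar>))"
  proof (rule sum.mono_neutral_right)
    show "\<forall>k\<in>{-K..K} - {k0}. (- 1) ^ nat \<bar>k\<bar> * binw 0 (nat \<bar>x - k * N\<bar>) = 0"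
    proof
      fix k assume "k \<in> {-K..K} - {k0}"
      then have "1 \<le> \<bar>k0 - k\<bar>" by auto
      then have "1 * N \<le> \<bar>k0 - k\<bar> * N" using N by (intro mult_right_mono) auto
      also have "\<dots> = \<bar>(k0 - k) * N\<bar>" using N by (simp add: abs_mult)
      also have "(k0 - k) * N = x - k * N - d" using kd by (simp add: algebra_simps)
      finally have "\<bar>x - k * N\<bar> > 1" using kd N by linarith
      then have "binw 0 (nat \<bar>x - k * N\<bar>) = 0" by (intro binw_eq_0) linarith
    then show "(- 1) ^ nat \<bar>k\<bar> * binw 0 (nat \<bar>x - k * N\<bar>) = 0" by simp
    qed
  qed (use k0 in auto)
  also have "\<dots> = (-1) ^ nat \<bar>k0\<bar> * binw 0 (nat \<bar>d\<bar>)" by (simp add: kd)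
  also have "binw 0 (nat \<bar>d\<bar>) = (wave N (d + 1) - wave N (d - 1)) / 2"
  proof -
    have w: "wave N 1 = 1" "wave N 2 = 1" "wave N (-1) = -1" "wave N (-2) = -1"
      using N wave_uminus[of N 1] wave_uminus[of N 2] by (auto simp: wave_small)
    consider "d = -1" | "d = 0" | "d = 1" using kd by linarith
    then show ?thesis by cases (simp_all add: w wave_0 binw_zero)
  qed
  also have "(-1) ^ nat \<bar>k0\<bar> * ((wave N (d + 1) - wave N (d - 1)) / 2) = (wave N (x + 1) - wave N (x - 1)) / 2"
    using wave_shift[of N k0 "d + 1"] wave_shift[of N k0 "d - 1"] N kd by (simp add: algebra_simps)
  finally show ?thesis by simp
next
  case False
  have "(\<Sum>k\<in>{-K..K}. (-1) ^ nat \<bar>k\<bar> * binw 0 (nat \<bar>x - k * N\<bar>)) = 0"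
  proof (rule sum.neutral, rule ballI)
    fix k
    have "\<not> \<bar>x - k * N\<bar> \<le> 1" using False by (metis add.commute diff_add_cancel)
    then have "binw 0 (nat \<bar>x - k * N\<bar>) = 0" by (intro binw_eq_0) linarith
    then show "(- 1) ^ nat \<bar>k\<bar> * binw 0 (nat \<bar>x - k * N\<bar>) = 0" by simp
  qed
  moreover have "wave N (x + 1) = wave N (x - 1)"
  proof -
    define q r where "q = x div N" and "r = x mod N"
    have x: "x = q * N + r" "0 \<le> r" "r < N" using N by (auto simp: q_def r_def)
    have "r > 1" using False x by (metis abs_of_nonneg not_le)
    moreover have "r < N - 1"
    proof (rule ccontr)
      assume "\<not> r < N - 1"
      then have "x = (q + 1) * N + (-1)" using x by (simp add: algebra_simps)
      then show False using False by (metis abs_1 abs_minus_cancel order_refl)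
    qed
    ultimately have "wave N (r + 1) = wave N (r - 1)" by (simp add: wave_small)
    moreover have "wave N (x + 1) = (-1) ^ nat \<bar>q\<bar> * wave N (r + 1)" "wave N (x - 1) = (-1) ^ nat \<bar>q\<bar> * wave N (r - 1)"
      using wave_shift[of N q "r + 1"] wave_shift[of N q "r - 1"] N x by (simp_all add: algebra_simps)
    ultimately show ?thesis by simp
  qed
  ultimately show ?thesis by simp
qed

text \<open>Both sides obey the same averaging recursion in \<open>n\<close>. The bound on
  \<open>n\<close> leaves room for the neighbours \<open>x - 1\<close> and \<open>x + 1\<close> in
  the induction, so that one finite range of images serves all earlier times.\<close>

lemma surv_difference:
  assumes N: "N \<ge> 3" and "\<bar>x\<bar> + int n + 1 \<le> K * N"
  shows "(surv N n (x + 1) - surv N n (x - 1)) / 2 = (\<Sum>k\<in>{-K..K}. (-1) ^ nat \<bar>k\<bar> * binw n (nat \<bar>x - k * N\<bar>))"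
  using assms(2)
proof (induction n arbitrary: x)
  case 0
  then show ?case using wave_difference[OF N, of x K] by simp
next
  case (Suc n)
  have "\<bar>x - 1\<bar> + int n + 1 \<le> K * N" "\<bar>x + 1\<bar> + int n + 1 \<le> K * N" using Suc.prems by linarith+
  from this[THEN Suc.IH]
  have a: "(surv N n x - surv N n (x - 2)) / 2 = (\<Sum>k\<in>{-K..K}. (-1) ^ nat \<bar>k\<bar> * binw n (nat \<bar>x - 1 - k * N\<bar>))"
    and b: "(surv N n (x + 2) - surv N n x) / 2 = (\<Sum>k\<in>{-K..K}. (-1) ^ nat \<bar>k\<bar> * binw n (nat \<bar>x + 1 - k * N\<bar>))"
    by (simp_all add: algebra_simps)
  have "(surv N (Suc n) (x + 1) - surv N (Suc n) (x - 1)) / 2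
     = ((surv N n x - surv N n (x - 2)) / 2 + (surv N n (x + 2) - surv N n x) / 2) / 2"
    by (simp add: field_simps)
  also have "\<dots> = (\<Sum>k\<in>{-K..K}. (-1) ^ nat \<bar>k\<bar> * binw (Suc n) (nat \<bar>x - k * N\<bar>))"
    unfolding a b binw_abs_Suc
    by (simp add: sum.distrib[symmetric] sum_divide_distrib algebra_simps)
  finally show ?case .
qed

lemma sum_symmetric_int:
  fixes \<phi> :: "nat \<Rightarrow> real"
  shows "(\<Sum>k\<in>{- int K..int K}. \<phi> (nat \<bar>k\<bar>)) = 2 * (\<Sum>j\<le>K. \<phi> j) - \<phi> 0"
proof (induction K)
  case (Suc K)
  have "{- int (Suc K)..int (Suc K)} = insert (int (Suc K)) (insert (- int (Suc K)) {- int K..int K})"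
    by auto
  then show ?case using Suc by (simp add: nat_add_distrib)
qed simp

text \<open>By oddness the value at 1 is half the difference across 0. The images \<open>k\<close>
  and \<open>- k\<close> contribute equally, while \<open>k = 0\<close> occurs once, hence the
  correction by \<open>binw n 0\<close>.\<close>

lemma surv_images:
  assumes N: "N \<ge> 3"
  shows "surv (int N) n 1 = 2 * (\<Sum>j. (-1) ^ j * binw n (j * N)) - binw n 0"
proof -
  \<comment> \<open>Large enough for \<open>surv_difference\<close> at 0, and all images beyond it
    have weight 0, so that the finite sum is the series.\<close>
  define K where "K = n + 1"
  have "int K * 1 \<le> int K * int N" using N by (intro mult_left_mono) auto
  moreover have "int K * 1 = int n + 1" by (simp add: K_def)
  ultimately have K: "int n + 1 \<le> int K * int N" by (simp only:)
  have "surv (int N) n 1 = (surv (int N) n (0 + 1) - surv (int N) n (0 - 1)) / 2"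
    using surv_uminus[of "int N" n 1] N by simp
  also have "\<dots> = (\<Sum>k\<in>{- int K..int K}. (-1) ^ nat \<bar>k\<bar> * binw n (nat \<bar>0 - k * int N\<bar>))"
    by (rule surv_difference) (use N K in auto)
  also have "\<dots> = (\<Sum>k\<in>{- int K..int K}. (-1) ^ nat \<bar>k\<bar> * binw n (nat \<bar>k\<bar> * N))"
    by (simp add: abs_mult nat_mult_distrib)
  also have "\<dots> = 2 * (\<Sum>j\<le>K. (-1) ^ j * binw n (j * N)) - binw n 0"
    by (subst sum_symmetric_int[where \<phi> = "\<lambda>j. (-1) ^ j * binw n (j * N)"]) simp
  also have "(\<Sum>j\<le>K. (-1) ^ j * binw n (j * N)) = (\<Sum>j. (-1) ^ j * binw n (j * N))"
  proof (rule suminf_finite[symmetric])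
    fix j assume "j \<notin> {..K}"
    then have "n + 1 < j * 1" by (simp add: K_def)
    also have "j * 1 \<le> j * N" using N by (intro mult_left_mono) auto
    finally show "(-1) ^ j * binw n (j * N) = 0" by (simp add: binw_eq_0)
  qed simp
  finally show ?thesis .
qed

lemma binw_images_tendsto_0:
  assumes "N > 0" shows "(\<lambda>j. binw n (j * N)) \<longlonglongrightarrow> 0"
proof (rule tendsto_eventually)
  show "\<forall>\<^sub>F j in sequentially. binw n (j * N) = 0"
    using eventually_gt_at_top[of "n + 1"]
  proof eventually_elim
    case (elim j)
    have "j * 1 \<le> j * N" using assms by (intro mult_left_mono) auto
    then show ?case using elim by (intro binw_eq_0) linarith
  qed
qed

text \<open>A decreasing alternating series is at most its first term, and that bound is the same
  for every \<open>N\<close>.\<close>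

lemma surv_le:
  assumes N: "N \<ge> 3" shows "surv (int N) n 1 \<le> 1 / sqrt (real n + 1)"
proof -
  have "(\<Sum>j. (-1) ^ j * binw n (j * N)) \<le> (\<Sum>j<2*0+1. (-1) ^ j * binw n (j * N))"
    using N by (intro summable_Leibniz'(4)[of "\<lambda>j. binw n (j * N)"] binw_images_tendsto_0 binw_antimono)
      (auto simp: binw_nonneg)
  then have "surv (int N) n 1 \<le> binw n 0" by (simp add: surv_images[OF N])
  also have "\<dots> \<le> 1 / sqrt (real n + 1)" by (rule binw_central_le)
  finally show ?thesis .
qed

section \<open>The order book\<close>

text \<open>Tracks the lowest occupied level. If it is hit, it is emptied and the level above takes
  over; otherwise only a new order below it can change it.\<close>

primrec ask :: "nat \<Rightarrow> (nat \<Rightarrow> int) \<Rightarrow> nat \<Rightarrow> int" where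
  "ask m s 0 = 0"
| "ask m s (Suc n) = s n + (if s n = ask m s n then 1 else min (ask m s n - s n) (int m))"

text \<open>After a trade (gap \<open>0\<close>) the ask moves up by one level, and at gap \<open>m + 1\<close> the new order at
  distance \<open>m\<close> pulls it down by one level.\<close>

definition gap_step :: "nat \<Rightarrow> int \<Rightarrow> int \<Rightarrow> int" where
  "gap_step m d x = (if d = 0 then 1 else min d (int m)) - x"

abbreviation gap :: "nat \<Rightarrow> int list \<Rightarrow> int" where
  "gap m xs \<equiv> foldl (gap_step m) 0 xs"

text \<open>The claims need each other. The occupied levels form a ray: the level emptied is either
  free already or the lowest of the ray, and \<open>ask m s n \<le> s n + int m + 1\<close> says
  that a new order falls into the ray or directly below it, so that no hole appears.\<close>

lemma ask_order_volume:
  assumes m: "m \<ge> 1" and s0: "s 0 = 0" and nn: "\<And>n. \<bar>s (Suc n) - s n\<bar> = 1"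
  shows "s n \<le> ask m s n \<and> ask m s n \<le> s n + int m + 1 \<and> (\<forall>u. 0 < order_volume m s n u \<longleftrightarrow> ask m s n \<le> u)"
proof (induction n)
  case 0
  then show ?case using s0 by simp
next
  case (Suc n)
  define a b where "a = ask m s n" and "b = ask m s (Suc n)"
  have b: "b = (if s n = a then s n + 1 else if a \<le> s n + int m then a else s n + int m)"
    by (simp add: a_def b_def min_def)
  have IH: "s n \<le> a" "a \<le> s n + int m + 1" "\<And>u. 0 < order_volume m s n u \<longleftrightarrow> a \<le> u"
    using Suc by (simp_all add: a_def)
  have "s (Suc n) = s n + 1 \<or> s (Suc n) = s n - 1" using nn[of n] by arith
  then have "s (Suc n) \<le> b" "b \<le> s (Suc n) + int m + 1"
    using b IH(1,2) m by (auto split: if_splits)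
  moreover have "0 < order_volume m s (Suc n) u \<longleftrightarrow> b \<le> u" for u
  proof -
    consider "u = s n" | "u \<noteq> s n" "u = s n + int m" | "u \<noteq> s n" "u \<noteq> s n + int m" by blast
    then show ?thesis
    proof cases
      case 1
      then show ?thesis using b IH(1) m by (simp split: if_splits)
    next
      case 2
      then show ?thesis using b IH(1) m by (simp split: if_splits)
    next
      case 3
      then have "0 < order_volume m s (Suc n) u \<longleftrightarrow> a \<le> u" using IH(3) by simp
      also have "a \<le> u \<longleftrightarrow> b \<le> u" using b IH(1,2) 3 m by (auto split: if_splits)
      finally show ?thesis .
    qed
  qed
  ultimately show ?case by (simp add: b_def)
qed

lemma ask_gap:
  assumes s0: "s 0 = 0"
  shows "ask m s n - s n = gap m (map (\<lambda>i. s (Suc i) - s i) [0..<n])"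
proof (induction n)
  case (Suc n)
  have "ask m s (Suc n) - s (Suc n) = gap_step m (ask m s n - s n) (s (Suc n) - s n)"
    by (simp add: gap_step_def)
  also have "\<dots> = gap m (map (\<lambda>i. s (Suc i) - s i) [0..<Suc n])"
    by (simp add: Suc)
  finally show ?case .
qed (simp add: s0)

lemma trade_iff_gap:
  assumes "m \<ge> 1" and "s 0 = 0" and "\<And>n. \<bar>s (Suc n) - s n\<bar> = 1"
  shows "0 < order_volume m s n (s n) \<longleftrightarrow> gap m (map (\<lambda>i. s (Suc i) - s i) [0..<n]) = 0"
  using ask_order_volume[OF assms, of n] ask_gap[of s m n, OF assms(2)] by fastforce

section \<open>Avalanches of a set of trading times\<close>

text \<open>For the set \<open>Z\<close> of trading times this says that the full avalanche length is \<open>j\<close>. It depends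
  only on the walk up to time \<open>j + w\<close>.\<close>

definition avalanche_at :: "nat \<Rightarrow> nat \<Rightarrow> (nat \<Rightarrow> bool) \<Rightarrow> bool" where
  "avalanche_at w j Z \<longleftrightarrow> Z j \<and> (\<forall>r. j < r \<and> r \<le> j + w \<longrightarrow> \<not> Z r) \<and>
     (\<forall>i<j. Z i \<longrightarrow> (\<exists>r. i < r \<and> r \<le> i + w \<and> Z r))"

lemma avalanche_at_cong:
  assumes "\<And>r. r \<le> j + w \<Longrightarrow> Z r = Z' r" shows "avalanche_at w j Z = avalanche_at w j Z'"
proof -
  have "(\<exists>r. i < r \<and> r \<le> i + w \<and> Z r) \<longleftrightarrow> (\<exists>r. i < r \<and> r \<le> i + w \<and> Z' r)" if "i < j" for i
    using assms that by (metis add_le_mono1 less_imp_le order_trans)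
  then show ?thesis unfolding avalanche_at_def using assms by (auto)
qed

lemma avalanche_at_unique:
  assumes "avalanche_at w j Z" "avalanche_at w j' Z" shows "j = j'"
proof (rule ccontr)
  assume "j \<noteq> j'"
  then consider "j < j'" | "j' < j" by linarith
  then show False using assms unfolding avalanche_at_def by cases blast+
qed

lemma avalanche_at_exists:
  assumes "Z j" "\<forall>r. j < r \<and> r \<le> j + w \<longrightarrow> \<not> Z r"
  shows "\<exists>j. avalanche_at w j Z"
proof -
  define P where "P = (\<lambda>j. Z j \<and> (\<forall>r. j < r \<and> r \<le> j + w \<longrightarrow> \<not> Z r))"
  define l where "l = (LEAST j. P j)"
  have "P j" using assms by (simp add: P_def)
  then have l: "P l" unfolding l_def by (rule LeastI)
  have least: "\<not> P i" if "i < l" for i using that unfolding l_def by (rule not_less_Least)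
  have "avalanche_at w l Z"
    unfolding avalanche_at_def
  proof (intro conjI allI impI)
    fix i assume "i < l" "Z i"
    then show "\<exists>r>i. r \<le> i + w \<and> Z r" using least[of i] by (simp add: P_def)
  qed (use l in \<open>simp_all add: P_def\<close>)
  then show ?thesis ..
qed

text \<open>Decomposition at the first trade \<open>i\<close>. Time 0 is a trade before
  \<open>j\<close>, so it must be followed by another one within the window; what remains is an
  avalanche of the path seen from time \<open>i\<close>.\<close>

lemma avalanche_at_rec:
  assumes Z0: "Z 0" and j: "0 < j"
  shows "avalanche_at w j Z \<longleftrightarrow>
    (\<exists>i\<in>{1..min j w}. (\<forall>r. 0 < r \<and> r < i \<longrightarrow> \<not> Z r) \<and> Z i \<and> avalanche_at w (j - i) (\<lambda>r. Z (i + r)))"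
proof
  assume L: "avalanche_at w j Z"
  then have Zj: "Z j" and *: "\<forall>i<j. Z i \<longrightarrow> (\<exists>r. i < r \<and> r \<le> i + w \<and> Z r)"
    by (simp_all add: avalanche_at_def)
  from *[rule_format, OF j Z0] obtain r where r: "0 < r" "r \<le> w" "Z r" by auto
  define i where "i = (LEAST i. 0 < i \<and> Z i)"
  have i: "0 < i \<and> Z i" unfolding i_def by (rule LeastI[of _ r]) (use r in simp)
  have imin: "\<not> Z k" if "0 < k" "k < i" for k using that not_less_Least[of k "\<lambda>i. 0 < i \<and> Z i"] by (auto simp: i_def)
  have "i \<le> w" using r imin[of r] by linarith
  moreover have "i \<le> j" using imin[of j] Zj j by (meson not_le)
  moreover have "avalanche_at w (j - i) (\<lambda>r. Z (i + r))"
    unfolding avalanche_at_def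
  proof (intro conjI allI impI)
    show "Z (i + (j - i))" using L \<open>i \<le> j\<close> unfolding avalanche_at_def by simp
    fix r assume "j - i < r \<and> r \<le> j - i + w"
    then have "j < i + r \<and> i + r \<le> j + w" using \<open>i \<le> j\<close> by auto
    then show "\<not> Z (i + r)" using L unfolding avalanche_at_def by blast
  next
    fix k assume "k < j - i" "Z (i + k)"
    then have "i + k < j" by simp
    then obtain r where "i + k < r" "r \<le> i + k + w" "Z r" using L \<open>Z (i + k)\<close> unfolding avalanche_at_def by blast
    then show "\<exists>r>k. r \<le> k + w \<and> Z (i + r)" by (intro exI[of _ "r - i"]) auto
  qed
  ultimately show "\<exists>i\<in>{1..min j w}. (\<forall>r. 0 < r \<and> r < i \<longrightarrow> \<not> Z r) \<and> Z i \<and> avalanche_at w (j - i) (\<lambda>r. Z (i + r))"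
    using i imin by (intro bexI[of _ i]) auto
next
  assume "\<exists>i\<in>{1..min j w}. (\<forall>r. 0 < r \<and> r < i \<longrightarrow> \<not> Z r) \<and> Z i \<and> avalanche_at w (j - i) (\<lambda>r. Z (i + r))"
  then obtain i where i': "i \<in> {1..min j w}" "\<forall>r. 0 < r \<and> r < i \<longrightarrow> \<not> Z r" "Z i"
    and L: "avalanche_at w (j - i) (\<lambda>r. Z (i + r))" by blast
  from i' have i: "0 < i" "i \<le> j" "i \<le> w" "\<And>r. 0 < r \<Longrightarrow> r < i \<Longrightarrow> \<not> Z r" "Z i" by simp_all
  show "avalanche_at w j Z"
    unfolding avalanche_at_def
  proof (intro conjI allI impI)
    show "Z j" using L i unfolding avalanche_at_def by simp
    fix r assume r: "j < r \<and> r \<le> j + w"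
    then have "j - i < r - i \<and> r - i \<le> j - i + w" using i by auto
    then have "\<not> Z (i + (r - i))" using L unfolding avalanche_at_def by blast
    then show "\<not> Z r" using r i by simp
  next
    fix k assume k: "k < j" "Z k"
    show "\<exists>r>k. r \<le> k + w \<and> Z r"
    proof (cases "k < i")
      case True
      then have "k = 0" using i k by (cases k) auto
      then show ?thesis using i by auto
    next
      case False
      then have "k - i < j - i" "Z (i + (k - i))" using k i by auto
      then obtain r where "k - i < r" "r \<le> k - i + w" "Z (i + r)" using L unfolding avalanche_at_def by blast
      then show ?thesis using False by (intro exI[of _ "i + r"]) auto
    qed
  qed
qed

text \<open>Every trade \<open>t \<le> j\<close> is a trading time reached through intertrading
  times of at most \<open>w\<close> that add up to \<open>t\<close>. After \<open>j\<close> the next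
  trade is more than \<open>w\<close> away, so the index of \<open>j\<close> is the least one in the
  definition.\<close>

lemma full_avalanche_length_eq:
  assumes s0: "s 0 = 0" and L: "avalanche_at w j (\<lambda>n. 0 < order_volume m s n (s n))"
  shows "full_avalanche_length m w s = j"
proof -
  define Z where "Z = (\<lambda>n. 0 < order_volume m s n (s n))"
  have Z0: "Z 0" by (simp add: Z_def s0)
  have L: "avalanche_at w j Z" using L by (simp add: Z_def)
  have next_time: "trading_time m s (Suc k) = enat t'"
    if k: "trading_time m s k = enat t" and t': "t < t'" "Z t'" "\<And>r. t < r \<Longrightarrow> r < t' \<Longrightarrow> \<not> Z r" for k t t'
  proof -
    have "trading_time m s (Suc k) = Inf {enat n |n. t < n \<and> Z n}" by (simp add: k Z_def)
    also have "\<dots> = enat t'"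
    proof (rule antisym)
      show "Inf {enat n |n. t < n \<and> Z n} \<le> enat t'" using t' by (intro Inf_lower) blast
      show "enat t' \<le> Inf {enat n |n. t < n \<and> Z n}"
      proof (rule Inf_greatest)
        fix x assume "x \<in> {enat n |n. t < n \<and> Z n}"
        then obtain n where "x = enat n" "t < n" "Z n" by blast
        then show "enat t' \<le> x" using t'(3)[of n] by (cases "n < t'") auto
      qed
    qed
    finally show ?thesis .
  qed
  have reach: "\<exists>k. trading_time m s k = enat t \<and> (\<forall>i<k. intertrading_time m s (Suc i) \<le> enat w) \<and>
      (\<Sum>i=1..k. intertrading_time m s i) = enat t" if "Z t" "t \<le> j" for t
    using that
  proof (induction t rule: less_induct)
    case (less t)
    show ?case
    proof (cases "t = 0")
      case True
      then show ?thesis by (intro exI[of _ 0]) (simp add: zero_enat_def)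
    next
      case False
      \<comment> \<open>The trade preceding \<open>t\<close>; it exists because time 0 counts as a
        trade.\<close>
      define p where "p = (GREATEST p. p < t \<and> Z p)"
      have p: "p < t \<and> Z p" unfolding p_def
        by (rule GreatestI_nat[of _ 0 t]) (use False Z0 in auto)
      have pmax: "\<not> Z r" if "p < r" "r < t" for r
        using Greatest_le_nat[of "\<lambda>p. p < t \<and> Z p" r t] that by (auto simp: p_def)
      have "p < j" using p less.prems by simp
      then obtain r where "p < r" "r \<le> p + w" "Z r" using L p unfolding avalanche_at_def by blast
      then have tw: "t \<le> p + w" using pmax[of r] by linarith
      obtain k where k: "trading_time m s k = enat p" "\<forall>i<k. intertrading_time m s (Suc i) \<le> enat w"
        "(\<Sum>i=1..k. intertrading_time m s i) = enat p" using less.IH[of p] p less.prems by auto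
      have "trading_time m s (Suc k) = enat t" using p pmax less.prems k by (intro next_time[of k p]) auto
      moreover from this have "intertrading_time m s (Suc k) = enat (t - p)"
        by (simp add: intertrading_time_def k del: trading_time.simps)
      ultimately show ?thesis using k tw p by (intro exI[of _ "Suc k"]) (auto simp: less_Suc_eq simp del: trading_time.simps)
    qed
  qed
  from L have "Z j" by (simp add: avalanche_at_def)
  from reach[OF this] obtain k where k: "trading_time m s k = enat j" "\<forall>i<k. intertrading_time m s (Suc i) \<le> enat w"
        "(\<Sum>i=1..k. intertrading_time m s i) = enat j" by auto
  have "enat (Suc (j + w)) \<le> trading_time m s (Suc k)"
  proof -
    have "trading_time m s (Suc k) = Inf {enat n |n. j < n \<and> Z n}" by (simp add: k Z_def)
    also have "\<dots> \<ge> enat (Suc (j + w))"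
      using L by (intro Inf_greatest) (auto simp: avalanche_at_def not_less_eq_eq[symmetric])
    finally show ?thesis .
  qed
  then have T: "intertrading_time m s (Suc k) > enat w"
    by (cases "trading_time m s (Suc k)") (auto simp: intertrading_time_def k simp del: trading_time.simps)
  have least: "(LEAST k. intertrading_time m s (Suc k) > enat w) = k"
  proof (rule Least_equality)
    fix y assume y: "enat w < intertrading_time m s (Suc y)"
    show "k \<le> y"
    proof (rule ccontr)
      assume "\<not> k \<le> y"
      then have "intertrading_time m s (Suc y) \<le> enat w" using k(2) by simp
      with y show False by simp
    qed
  qed (fact T)
  have ex: "\<exists>k. intertrading_time m s (Suc k) > enat w" using T by blast
  show ?thesis
    by (simp only: full_avalanche_length_def if_P[OF ex] least k(3) the_enat.simps)
qed

text \<open>Here each trade is followed by another within \<open>w\<close>, so the default value 0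
  of the definition applies. With the preceding lemma this determines the length on every path that
  starts at 0.\<close>

lemma full_avalanche_length_none:
  assumes s0: "s 0 = 0" and L: "\<And>j. \<not> avalanche_at w j (\<lambda>n. 0 < order_volume m s n (s n))"
  shows "full_avalanche_length m w s = 0"
proof -
  define Z where "Z = (\<lambda>n. 0 < order_volume m s n (s n))"
  have Z0: "Z 0" by (simp add: Z_def s0)
  have ex: "\<exists>r. t < r \<and> r \<le> t + w \<and> Z r" if "Z t" for t
  proof (rule ccontr)
    assume "\<not> (\<exists>r. t < r \<and> r \<le> t + w \<and> Z r)"
    then have "\<forall>r. t < r \<and> r \<le> t + w \<longrightarrow> \<not> Z r" by blast
    from avalanche_at_exists[of Z, OF that this] show False using L unfolding Z_def by blast
  qed
  have le: "intertrading_time m s (Suc k) \<le> enat w"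
    "\<exists>t. trading_time m s (Suc k) = enat t \<and> Z t" if k: "trading_time m s k = enat t" "Z t" for k t
  proof -
    obtain r where r: "t < r" "r \<le> t + w" "Z r" using ex[OF k(2)] by blast
    define A where "A = {enat n |n. t < n \<and> Z n}"
    have e: "trading_time m s (Suc k) = Inf A" by (simp add: k Z_def A_def)
    have "enat r \<in> A" using r by (auto simp: A_def)
    then have le: "Inf A \<le> enat r" by (rule Inf_lower)
    have "Inf A \<in> A" using \<open>enat r \<in> A\<close> by (auto simp: Inf_enat_def intro: LeastI)
    then obtain n where n: "Inf A = enat n" "Z n" by (auto simp: A_def)
    show "\<exists>t. trading_time m s (Suc k) = enat t \<and> Z t" using e n by simp
    show "intertrading_time m s (Suc k) \<le> enat w"
      using e n le r by (simp add: intertrading_time_def k del: trading_time.simps)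
  qed
  have "\<exists>t. trading_time m s k = enat t \<and> Z t" for k
    by (induction k) (use Z0 le(2) in \<open>auto simp: zero_enat_def simp del: trading_time.simps(2)\<close>)
  then have "intertrading_time m s (Suc k) \<le> enat w" for k using le(1) by blast
  then show ?thesis unfolding full_avalanche_length_def by (simp add: not_less[symmetric])
qed

section \<open>Counting coin sequences\<close>

definition coin_lists :: "nat \<Rightarrow> int list set" where
  "coin_lists n = {xs. set xs \<subseteq> {-1, 1} \<and> length xs = n}"

definition coin_prob :: "nat \<Rightarrow> (int list \<Rightarrow> bool) \<Rightarrow> real" where
  "coin_prob n P = card {xs \<in> coin_lists n. P xs} / 2 ^ n"

lemma finite_coin_lists: "finite (coin_lists n)"
  unfolding coin_lists_def by (rule finite_lists_length_eq) simp

lemma card_coin_lists: "card (coin_lists n) = 2 ^ n"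
  unfolding coin_lists_def by (subst card_lists_length_eq) (auto simp: numeral_2_eq_2)

lemma coin_prob_nonneg: "0 \<le> coin_prob n P"
  by (simp add: coin_prob_def)

lemma coin_prob_True: "coin_prob n (\<lambda>_. True) = 1"
  by (simp add: coin_prob_def card_coin_lists)

lemma coin_prob_cong:
  assumes "\<And>xs. length xs = n \<Longrightarrow> P xs = Q xs" shows "coin_prob n P = coin_prob n Q"
proof -
  have "{xs \<in> coin_lists n. P xs} = {xs \<in> coin_lists n. Q xs}"
    using assms by (auto simp: coin_lists_def)
  then show ?thesis by (simp add: coin_prob_def)
qed

text \<open>Independence of two consecutive blocks of coins, as a product of cardinalities.\<close>

lemma coin_prob_append:
  "coin_prob (i + n) (\<lambda>xs. A (take i xs) \<and> B (drop i xs)) = coin_prob i A * coin_prob n B"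
proof -
  have "bij_betw (\<lambda>(xs, ys). xs @ ys) ({xs \<in> coin_lists i. A xs} \<times> {xs \<in> coin_lists n. B xs})
      {xs \<in> coin_lists (i + n). A (take i xs) \<and> B (drop i xs)}"
    by (rule bij_betw_byWitness[where f' = "\<lambda>xs. (take i xs, drop i xs)"])
      (auto simp: coin_lists_def dest: in_set_takeD in_set_dropD)
  from bij_betw_same_card[OF this] show ?thesis
    by (simp add: coin_prob_def card_cartesian_product power_add flip: of_nat_mult)
qed

lemma coin_prob_Suc:
  "coin_prob (Suc n) P = (coin_prob n (\<lambda>xs. P (1 # xs)) + coin_prob n (\<lambda>xs. P (-1 # xs))) / 2"
proof -
  have eq: "{xs \<in> coin_lists (Suc n). P xs} =
      (#) 1 ` {xs \<in> coin_lists n. P (1 # xs)} \<union> (#) (-1) ` {xs \<in> coin_lists n. P (-1 # xs)}"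
    by (auto simp: coin_lists_def length_Suc_conv)
  have "card {xs \<in> coin_lists (Suc n). P xs} =
      card {xs \<in> coin_lists n. P (1 # xs)} + card {xs \<in> coin_lists n. P (-1 # xs)}"
    unfolding eq using finite_coin_lists[of n]
    by (subst card_Un_disjoint) (auto simp: card_image)
  then show ?thesis by (simp add: coin_prob_def field_simps)
qed

lemma coin_prob_UN:
  assumes "finite I" and "\<And>xs i i'. i \<in> I \<Longrightarrow> i' \<in> I \<Longrightarrow> length xs = n \<Longrightarrow> Q i xs \<Longrightarrow> Q i' xs \<Longrightarrow> i = i'"
  shows "coin_prob n (\<lambda>xs. \<exists>i\<in>I. Q i xs) = (\<Sum>i\<in>I. coin_prob n (Q i))"
proof -
  have fin: "finite {xs \<in> coin_lists n. R xs}" for R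
    using finite_coin_lists[of n] by simp
  have "{xs \<in> coin_lists n. \<exists>i\<in>I. Q i xs} = (\<Union>i\<in>I. {xs \<in> coin_lists n. Q i xs})" by auto
  also have "card \<dots> = (\<Sum>i\<in>I. card {xs \<in> coin_lists n. Q i xs})"
    by (intro card_UN_disjoint ballI fin) (use assms in \<open>auto simp: coin_lists_def\<close>)
  finally show ?thesis by (simp add: coin_prob_def sum_divide_distrib)
qed

lemma coin_prob_split:
  "coin_prob n P = coin_prob n (\<lambda>xs. P xs \<and> Q xs) + coin_prob n (\<lambda>xs. P xs \<and> \<not> Q xs)"
proof -
  have "{xs \<in> coin_lists n. P xs} = {xs \<in> coin_lists n. P xs \<and> Q xs} \<union> {xs \<in> coin_lists n. P xs \<and> \<not> Q xs}"
    by auto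
  also have "card \<dots> = card {xs \<in> coin_lists n. P xs \<and> Q xs} + card {xs \<in> coin_lists n. P xs \<and> \<not> Q xs}"
    using finite_coin_lists[of n] by (intro card_Un_disjoint) auto
  finally show ?thesis by (simp add: coin_prob_def add_divide_distrib)
qed

section \<open>The law of the intertrading time\<close>

definition no_trade :: "nat \<Rightarrow> int \<Rightarrow> int list \<Rightarrow> bool" where
  "no_trade m d xs \<longleftrightarrow> (\<forall>r. 0 < r \<and> r \<le> length xs \<longrightarrow> foldl (gap_step m) d (take r xs) \<noteq> 0)"

lemma no_trade_Nil: "no_trade m d []"
  by (auto simp: no_trade_def)

lemma no_trade_Cons:
  "no_trade m d (x # xs) \<longleftrightarrow> gap_step m d x \<noteq> 0 \<and> no_trade m (gap_step m d x) xs"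
proof
  assume L: "no_trade m d (x # xs)"
  have "gap_step m d x \<noteq> 0" using L[unfolded no_trade_def, rule_format, of 1] by simp
  moreover have "foldl (gap_step m) (gap_step m d x) (take r xs) \<noteq> 0" if "0 < r" "r \<le> length xs" for r
    using L[unfolded no_trade_def, rule_format, of "Suc r"] that by simp
  ultimately show "gap_step m d x \<noteq> 0 \<and> no_trade m (gap_step m d x) xs" by (simp add: no_trade_def)
next
  assume R: "gap_step m d x \<noteq> 0 \<and> no_trade m (gap_step m d x) xs"
  show "no_trade m d (x # xs)" unfolding no_trade_def
  proof (intro allI impI)
    fix r assume r: "0 < r \<and> r \<le> length (x # xs)"
    then obtain r' where r': "r = Suc r'" "r' \<le> length xs" by (cases r) auto
    show "foldl (gap_step m) d (take r (x # xs)) \<noteq> 0"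
      using R r' by (cases "r' = 0") (auto simp: no_trade_def)
  qed
qed

text \<open>The two boundaries of the reflected walk become properties of \<open>surv\<close>: a
  step from 1 to gap 0 is absorbed since \<open>surv N n 0 = 0\<close>, and the folding at the top
  is the symmetry of \<open>surv\<close> about \<open>N / 2\<close>. The argument on the right is
  the gap just before the price moves, which is 1 after a trade.\<close>

lemma coin_prob_no_trade:
  assumes m: "m \<ge> 1" and d: "d \<ge> 0"
  shows "coin_prob n (no_trade m d) = surv (int (2 * m + 1)) n (if d = 0 then 1 else min d (int m))"
  using d
proof (induction n arbitrary: d)
  case 0
  have "coin_prob 0 (no_trade m d) = coin_prob 0 (\<lambda>_. True)"
    by (rule coin_prob_cong) (simp add: no_trade_Nil)
  then show ?case using 0 m by (auto simp: coin_prob_True wave_small min_def)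
next
  case (Suc n)
  define e where "e = (if d = 0 then 1 else min d (int m))"
  define N where "N = int (2 * m + 1)"
  have N: "N > 0" by (simp add: N_def)
  have e: "1 \<le> e" "e \<le> int m" using Suc.prems m by (auto simp: e_def min_def)
  have minus: "coin_prob n (\<lambda>xs. no_trade m d (1 # xs)) = surv N n (e - 1)"
  proof (cases "e = 1")
    case True
    then have "coin_prob n (\<lambda>xs. no_trade m d (1 # xs)) = 0"
      by (simp add: no_trade_Cons gap_step_def e_def[symmetric] coin_prob_def)
    then show ?thesis using True N by (simp add: surv_zero)
  next
    case False
    then have "coin_prob n (\<lambda>xs. no_trade m d (1 # xs)) = coin_prob n (no_trade m (e - 1))"
      by (intro coin_prob_cong) (simp add: no_trade_Cons gap_step_def e_def[symmetric])
    also have "\<dots> = surv N n (e - 1)"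
      using Suc.IH[of "e - 1"] e False by (simp add: N_def min_def)
    finally show ?thesis .
  qed
  have "coin_prob n (\<lambda>xs. no_trade m d (-1 # xs)) = coin_prob n (no_trade m (e + 1))"
    using e by (intro coin_prob_cong) (simp add: no_trade_Cons gap_step_def e_def[symmetric])
  also have "\<dots> = surv N n (min (e + 1) (int m))"
    using Suc.IH[of "e + 1"] e by (simp add: N_def)
  \<comment> \<open>From \<open>e = m\<close> the gap becomes \<open>m + 1\<close>, which behaves
    like \<open>m\<close>; reflection exchanges these two points because
    \<open>N = 2 * m + 1\<close>.\<close>
  also have "\<dots> = surv N n (e + 1)"
  proof (cases "e = int m")
    case True
    have "surv N n (N - int m) = surv N n (int m)" by (rule surv_reflect[OF N])
    moreover have "N - int m = e + 1" by (simp add: True N_def)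
    ultimately show ?thesis using True by simp
  qed (use e in simp)
  finally have plus: "coin_prob n (\<lambda>xs. no_trade m d (-1 # xs)) = surv N n (e + 1)" .
  show ?case unfolding coin_prob_Suc e_def[symmetric] N_def[symmetric] minus plus by simp
qed

text \<open>The \<open>f n\<close> of the overview for spread \<open>m\<close>;
  \<open>coin_prob_no_trade\<close> supplies the probabilistic reading.\<close>

definition tail_prob :: "nat \<Rightarrow> nat \<Rightarrow> real" where
  "tail_prob m n = surv (int (2 * m + 1)) n 1"

lemma tail_prob_eq: "m \<ge> 1 \<Longrightarrow> tail_prob m n = coin_prob n (no_trade m 0)"
  by (simp add: tail_prob_def coin_prob_no_trade)

lemma tail_prob_0: "m \<ge> 1 \<Longrightarrow> tail_prob m 0 = 1"
  by (simp add: tail_prob_def wave_small)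

text \<open>A price that only falls never meets the book again after time 0, and this path alone has
  positive probability.\<close>

lemma tail_prob_pos:
  assumes "m \<ge> 1" shows "0 < tail_prob m n"
proof -
  have "no_trade m d (replicate n (-1))" if "d \<ge> 0" for d
    using that
  proof (induction n arbitrary: d)
    case (Suc n)
    have "gap_step m d (-1) > 0" using Suc.prems assms by (auto simp: gap_step_def min_def)
    with Suc.IH[of "gap_step m d (-1)"] show ?case by (simp add: no_trade_Cons)
  qed (simp add: no_trade_Nil)
  then have "replicate n (-1) \<in> {xs \<in> coin_lists n. no_trade m 0 xs}"
    by (auto simp: coin_lists_def)
  then have "card {xs \<in> coin_lists n. no_trade m 0 xs} \<noteq> 0" using finite_coin_lists[of n] by auto
  then show ?thesis by (simp add: tail_prob_eq[OF assms] coin_prob_def)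
qed

lemma coin_prob_first_trade:
  assumes m: "m \<ge> 1"
  shows "coin_prob (Suc i) (\<lambda>xs. (\<forall>r. 0 < r \<and> r < Suc i \<longrightarrow> gap m (take r xs) \<noteq> 0) \<and> gap m (take (Suc i) xs) = 0)
    = tail_prob m i - tail_prob m (Suc i)"
proof -
  define A where "A = (\<lambda>xs. \<forall>r. 0 < r \<and> r < Suc i \<longrightarrow> gap m (take r xs) \<noteq> 0)"
  have "coin_prob (Suc i) A = coin_prob (i + 1) (\<lambda>xs. no_trade m 0 (take i xs) \<and> True)"
    unfolding Suc_eq_plus1
    by (rule coin_prob_cong) (auto simp: A_def no_trade_def min_def less_Suc_eq_le)
  also have "\<dots> = tail_prob m i"
    using coin_prob_append[of i 1 "no_trade m 0" "\<lambda>_. True"] by (simp add: coin_prob_True tail_prob_eq[OF m])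
  finally have 1: "coin_prob (Suc i) A = tail_prob m i" .
  have "coin_prob (Suc i) (\<lambda>xs. A xs \<and> \<not> gap m (take (Suc i) xs) = 0) = tail_prob m (Suc i)"
    unfolding tail_prob_eq[OF m]
    by (rule coin_prob_cong) (auto simp: A_def no_trade_def le_less)
  with 1 coin_prob_split[of "Suc i" A "\<lambda>xs. gap m (take (Suc i) xs) = 0"] show ?thesis
    by (simp add: A_def)
qed

lemma tail_prob_Suc_le: "m \<ge> 1 \<Longrightarrow> tail_prob m (Suc i) \<le> tail_prob m i"
  using coin_prob_first_trade[of m i] coin_prob_nonneg[of "Suc i"
    "\<lambda>xs. (\<forall>r. 0 < r \<and> r < Suc i \<longrightarrow> gap m (take r xs) \<noteq> 0) \<and> gap m (take (Suc i) xs) = 0"] by linarith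

section \<open>Renewal equation\<close>

definition avalanche_prob :: "nat \<Rightarrow> nat \<Rightarrow> nat \<Rightarrow> real" where
  "avalanche_prob m w j = coin_prob (j + w) (\<lambda>xs. avalanche_at w j (\<lambda>r. gap m (take r xs) = 0))"

lemma avalanche_prob_0: "m \<ge> 1 \<Longrightarrow> avalanche_prob m w 0 = tail_prob m w"
  unfolding avalanche_prob_def tail_prob_eq
  by (auto intro!: coin_prob_cong simp: avalanche_at_def no_trade_def)

text \<open>Regeneration: a trade resets the gap to its initial value 0.\<close>

lemma gap_take_add: "gap m (take i xs) = 0 \<Longrightarrow> gap m (take (i + r) xs) = gap m (take r (drop i xs))"
  by (simp add: take_add)

text \<open>The renewal equation. The \<open>j + w\<close> coins split into \<open>i\<close> coins
  up to the first trade and \<open>(j - i) + w\<close> coins that drive a fresh copy of the book,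
  and different \<open>i\<close> give disjoint events.\<close>

lemma avalanche_prob_rec:
  assumes m: "m \<ge> 1" and j: "0 < j"
  shows "avalanche_prob m w j =
    (\<Sum>i\<in>{1..min j w}. (tail_prob m (i - 1) - tail_prob m i) * avalanche_prob m w (j - i))"
proof -
  define F where "F = (\<lambda>i xs. (\<forall>r. 0 < r \<and> r < i \<longrightarrow> gap m (take r xs) \<noteq> 0) \<and> gap m (take i xs) = 0)"
  define Z where "Z = (\<lambda>xs r. gap m (take r xs) = 0)"
  have "avalanche_at w j (Z xs) \<longleftrightarrow>
    (\<exists>i\<in>{1..min j w}. F i (take i xs) \<and> avalanche_at w (j - i) (Z (drop i xs)))" for xs
  proof -
    have 1: "avalanche_at w j (Z xs) \<longleftrightarrow> (\<exists>i\<in>{1..min j w}. (\<forall>r. 0 < r \<and> r < i \<longrightarrow> \<not> Z xs r) \<and> Z xs i \<and>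
      avalanche_at w (j - i) (\<lambda>r. Z xs (i + r)))"
      by (rule avalanche_at_rec) (auto simp: Z_def j)
    have 2: "(\<forall>r. 0 < r \<and> r < i \<longrightarrow> \<not> Z xs r) \<and> Z xs i \<longleftrightarrow> F i (take i xs)" for i
      by (auto simp: F_def Z_def)
    have 3: "(\<lambda>r. Z xs (i + r)) = Z (drop i xs)" if "Z xs i" for i
      using that by (auto simp: Z_def gap_take_add)
    have 4: "Z xs i" if "F i (take i xs)" for i using that by (simp add: F_def Z_def)
    show ?thesis unfolding 1 using 2 3 4 by metis
  qed
  then have "avalanche_prob m w j = coin_prob (j + w)
      (\<lambda>xs. \<exists>i\<in>{1..min j w}. F i (take i xs) \<and> avalanche_at w (j - i) (Z (drop i xs)))"
    by (simp add: avalanche_prob_def Z_def)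
  also have "\<dots> = (\<Sum>i\<in>{1..min j w}. coin_prob (j + w) (\<lambda>xs. F i (take i xs) \<and> avalanche_at w (j - i) (Z (drop i xs))))"
  proof (rule coin_prob_UN)
    fix xs i i'
    assume i: "i \<in> {1..min j w}" "i' \<in> {1..min j w}"
      and F: "F i (take i xs) \<and> avalanche_at w (j - i) (Z (drop i xs))"
        "F i' (take i' xs) \<and> avalanche_at w (j - i') (Z (drop i' xs))"
    have False if "k < k'" "0 < k" "F k (take k xs)" "F k' (take k' xs)" for k k'
    proof -
      have "gap m (take k (take k' xs)) \<noteq> 0" using that unfolding F_def by blast
      moreover have "gap m (take k (take k xs)) = 0" using that unfolding F_def by blast
      ultimately show False using that by (simp add: min_def)
    qed
    from this[of i i'] this[of i' i] show "i = i'" using i F by (cases i i' rule: linorder_cases) auto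
  qed simp
  also have "\<dots> = (\<Sum>i\<in>{1..min j w}. (tail_prob m (i - 1) - tail_prob m i) * avalanche_prob m w (j - i))"
  proof (rule sum.cong)
    fix i assume i: "i \<in> {1..min j w}"
    then have e: "j + w = i + (j - i + w)" and S: "Suc (i - 1) = i" by auto
    have "coin_prob (i + (j - i + w)) (\<lambda>xs. F i (take i xs) \<and> avalanche_at w (j - i) (Z (drop i xs)))
      = coin_prob i (F i) * avalanche_prob m w (j - i)"
      using coin_prob_append[of i "j - i + w" "F i" "\<lambda>ys. avalanche_at w (j - i) (Z ys)"]
      by (simp only: avalanche_prob_def Z_def)
    then show "coin_prob (j + w) (\<lambda>xs. F i (take i xs) \<and> avalanche_at w (j - i) (Z (drop i xs)))
      = (tail_prob m (i - 1) - tail_prob m i) * avalanche_prob m w (j - i)"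
      using coin_prob_first_trade[OF m, of "i - 1"] unfolding e[symmetric] S F_def by simp
  qed simp
  finally show ?thesis .
qed

lemma avalanche_prob_nonneg: "0 \<le> avalanche_prob m w j"
  by (simp add: avalanche_prob_def coin_prob_nonneg)

lemma sum_tail_prob:
  assumes "m \<ge> 1" shows "(\<Sum>i\<in>{1..w}. tail_prob m (i - 1) - tail_prob m i) = 1 - tail_prob m w"
  by (induction w) (simp_all add: tail_prob_0[OF assms])

text \<open>The renewal equation is a convolution, so generating functions turn it into
  \<open>C = s * C + c 0\<close>. Here \<open>s < 1\<close>, since the intertrading time exceeds the
  window with positive probability. The case \<open>q = 1\<close> is included on purpose: it gives
  total mass 1.\<close>

lemma avalanche_prob_sums:
  assumes m: "m \<ge> 1" and q: "0 \<le> q" "q \<le> 1"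
  shows "(\<lambda>j. q ^ j * avalanche_prob m w j) sums
    (tail_prob m w / (1 - (\<Sum>i\<in>{1..w}. q ^ i * (tail_prob m (i - 1) - tail_prob m i))))"
proof -
  define c where "c = (\<lambda>j. q ^ j * avalanche_prob m w j)"
  define p where "p = (\<lambda>i. if i \<in> {1..w} then q ^ i * (tail_prob m (i - 1) - tail_prob m i) else 0)"
  define s where "s = (\<Sum>i\<in>{1..w}. q ^ i * (tail_prob m (i - 1) - tail_prob m i))"
  have c_nn: "0 \<le> c j" for j using q by (simp add: c_def avalanche_prob_nonneg)
  have dp: "0 \<le> tail_prob m (i - 1) - tail_prob m i" for i
    using tail_prob_Suc_le[OF m, of "i - 1"] by (cases i) auto
  have p_nn: "0 \<le> p i" for i using q dp by (simp add: p_def)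
  have "s \<le> (\<Sum>i\<in>{1..w}. tail_prob m (i - 1) - tail_prob m i)" unfolding s_def
    using q dp by (intro sum_mono mult_left_le_one_le) (auto intro: power_le_one)
  also have "\<dots> < 1" using sum_tail_prob[OF m] tail_prob_pos[OF m] by simp
  finally have s1: "s < 1" .
  have p_sums: "p sums s" unfolding p_def s_def by (rule sums_If_finite_set') (auto intro: sums_0)
  have c_rec: "c j = (\<Sum>i\<le>j. p i * c (j - i))" if "j > 0" for j
  proof -
    have "c j = (\<Sum>i\<in>{1..min j w}. q ^ j * ((tail_prob m (i - 1) - tail_prob m i) * avalanche_prob m w (j - i)))"
      unfolding c_def avalanche_prob_rec[OF m that] by (simp add: sum_distrib_left)
    also have "\<dots> = (\<Sum>i\<in>{1..min j w}. p i * c (j - i))"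
    proof (rule sum.cong)
      fix i assume "i \<in> {1..min j w}"
      then have "q ^ j = q ^ i * q ^ (j - i)" "p i = q ^ i * (tail_prob m (i - 1) - tail_prob m i)"
        by (auto simp: power_add[symmetric] p_def)
      then show "q ^ j * ((tail_prob m (i - 1) - tail_prob m i) * avalanche_prob m w (j - i)) = p i * c (j - i)"
        by (simp add: c_def mult_ac)
    qed simp
    also have "\<dots> = (\<Sum>i\<le>j. p i * c (j - i))"
      by (rule sum.mono_neutral_left) (auto simp: p_def)
    finally show ?thesis .
  qed
  have c0: "c 0 = tail_prob m w" by (simp add: c_def avalanche_prob_0[OF m])
  \<comment> \<open>Convergence has to precede the product formula. The partial sums
    \<open>C\<close> satisfy \<open>C \<le> c 0 + s * C\<close>, because enlarging the triangle of
    the convolution to a square only adds nonnegative terms.\<close>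
  have "summable c"
  proof (rule summableI_nonneg_bounded)
    fix n
    have "(\<Sum>j<n. c j) \<le> c 0 + (\<Sum>j<n. \<Sum>i\<le>j. p i * c (j - i))"
    proof (cases n)
      case (Suc n')
      have "(\<Sum>j<n. c j) = c 0 + (\<Sum>j\<in>{1..<n}. c j)"
        unfolding Suc lessThan_atLeast0 by (simp add: sum.atLeast_Suc_lessThan)
      also have "(\<Sum>j\<in>{1..<n}. c j) = (\<Sum>j\<in>{1..<n}. \<Sum>i\<le>j. p i * c (j - i))"
        by (intro sum.cong c_rec) auto
      also have "\<dots> \<le> (\<Sum>j<n. \<Sum>i\<le>j. p i * c (j - i))"
        by (rule sum_mono2) (auto intro!: sum_nonneg mult_nonneg_nonneg p_nn c_nn)
      finally show ?thesis by simp
    qed (simp add: c_nn)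
    also have "(\<Sum>j<n. \<Sum>i\<le>j. p i * c (j - i)) = (\<Sum>(i, k)\<in>{(i, k). i + k < n}. p i * c k)"
      by (rule sum.triangle_reindex[symmetric])
    also have "\<dots> \<le> (\<Sum>(i, k)\<in>{..<n} \<times> {..<n}. p i * c k)"
      by (rule sum_mono2) (auto intro!: mult_nonneg_nonneg p_nn c_nn)
    also have "\<dots> = (\<Sum>i<n. p i) * (\<Sum>k<n. c k)"
      by (simp add: sum_product sum.cartesian_product)
    also have "\<dots> \<le> s * (\<Sum>k<n. c k)"
      using sum_le_suminf[OF sums_summable[OF p_sums], of "{..<n}"] p_nn sums_unique[OF p_sums]
      by (intro mult_right_mono sum_nonneg c_nn) auto
    finally have "(1 - s) * (\<Sum>j<n. c j) \<le> c 0" by (simp add: algebra_simps)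
    then show "(\<Sum>j<n. c j) \<le> c 0 / (1 - s)" using s1 by (simp add: field_simps)
  qed (rule c_nn)
  define C where "C = (\<Sum>k. c k)"
  have C: "c sums C" unfolding C_def by (rule summable_sums) fact
  have "(\<lambda>j. \<Sum>i\<le>j. p i * c (j - i)) sums ((\<Sum>i. p i) * (\<Sum>k. c k))"
    using sums_summable[OF p_sums] \<open>summable c\<close> p_nn c_nn by (intro Cauchy_product_sums) auto
  moreover have "(\<Sum>i. p i) = s" using p_sums by (rule sums_unique[symmetric])
  moreover have "p 0 = 0" by (simp add: p_def)
  \<comment> \<open>The recursion holds for positive indices only. As \<open>p 0 = 0\<close>, the
    zeroth coefficient of the product vanishes and the shifted series keeps the full sum.\<close>
  ultimately have "(\<lambda>j. \<Sum>i\<le>Suc j. p i * c (Suc j - i)) sums (s * C)"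
    by (subst sums_Suc_iff) (simp add: C_def)
  then have "(\<lambda>j. c (Suc j)) sums (s * C)" using c_rec by simp
  then have "c sums (s * C + c 0)" by (rule sums_Suc)
  then have "C = s * C + c 0" using C sums_unique2 by blast
  then have "C = c 0 / (1 - s)" using s1 by (simp add: field_simps)
  then show ?thesis using C c0 by (simp add: c_def s_def)
qed

section \<open>Laplace transform of the full avalanche length\<close>

context simple_symmetric_random_walk
begin

definition X :: "nat \<Rightarrow> 'a \<Rightarrow> int" where
  "X i \<omega> = S (Suc i) \<omega> - S i \<omega>"

lemma indep_X: "indep_vars (\<lambda>_. count_space UNIV) X UNIV"
  using indep_increments unfolding X_def[abs_def] .

lemma X_measurable [measurable]: "X i \<in> measurable M (count_space UNIV)"
  using indep_X unfolding indep_vars_def by auto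

lemma prob_X:
  assumes "a = -1 \<or> a = 1" shows "prob {\<omega> \<in> space M. X i \<omega> = a} = 1 / 2"
proof -
  have "prob {\<omega> \<in> space M. X i \<omega> = a} = measure (distr M (count_space UNIV) (X i)) {a}"
    by (subst measure_distr) (auto intro!: arg_cong[where f = prob])
  also have "\<dots> = pmf (pmf_of_set {-1, 1}) a"
    using increment_distr[of i] unfolding X_def[abs_def] by (simp add: pmf.rep_eq)
  also have "\<dots> = 1 / 2" using assms by (auto simp: indicator_def)
  finally show ?thesis .
qed

lemma AE_X: "AE \<omega> in M. \<forall>i. X i \<omega> \<in> {-1, 1}"
  unfolding AE_all_countable
proof
  fix i
  have "prob {\<omega> \<in> space M. X i \<omega> \<in> {-1, 1}} = prob ({\<omega> \<in> space M. X i \<omega> = -1} \<union> {\<omega> \<in> space M. X i \<omega> = 1})"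
    by (rule arg_cong[where f = prob]) auto
  also have "\<dots> = prob {\<omega> \<in> space M. X i \<omega> = -1} + prob {\<omega> \<in> space M. X i \<omega> = 1}"
    by (rule finite_measure_Union) auto
  also have "\<dots> = 1" by (simp add: prob_X)
  finally show "AE \<omega> in M. X i \<omega> \<in> {-1, 1}"
    by (subst (asm) prob_Collect_eq_1) auto
qed

lemma X_list_measurable [measurable]:
  "(\<lambda>\<omega>. map (\<lambda>i. X i \<omega>) [0..<n]) \<in> measurable M (count_space UNIV)"
proof (induction n)
  case (Suc n)
  have 1: "(\<lambda>\<omega>. xs @ [X n \<omega>]) \<in> measurable M (count_space UNIV)" for xs
    by (rule measurable_compose[OF X_measurable]) simp
  have "(\<lambda>\<omega>. (\<lambda>xs \<omega>. xs @ [X n \<omega>]) (map (\<lambda>i. X i \<omega>) [0..<n]) \<omega>) \<in> measurable M (count_space UNIV)"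
    by (rule measurable_compose_countable[OF 1 Suc])
  then show ?case by simp
qed simp

lemma prob_X_list:
  assumes xs: "xs \<in> coin_lists n"
  shows "prob {\<omega> \<in> space M. map (\<lambda>i. X i \<omega>) [0..<n] = xs} = 1 / 2 ^ n"
proof (cases "n = 0")
  case True
  then show ?thesis using xs by (simp add: coin_lists_def prob_space)
next
  case False
  have len: "length xs = n" and set: "set xs \<subseteq> {-1, 1}" using xs by (simp_all add: coin_lists_def)
  have el: "xs ! i = -1 \<or> xs ! i = 1" if "i < n" for i
    using subsetD[OF set nth_mem[of i xs]] that len by simp
  have "{\<omega> \<in> space M. map (\<lambda>i. X i \<omega>) [0..<n] = xs} = (\<Inter>i\<in>{..<n}. X i -` {xs ! i} \<inter> space M)"
    using False len by (auto simp: list_eq_iff_nth_eq)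
  also have "prob \<dots> = (\<Prod>i\<in>{..<n}. prob (X i -` {xs ! i} \<inter> space M))"
    using False by (intro indep_varsD[OF indep_X]) auto
  also have "\<dots> = (\<Prod>i\<in>{..<n}. 1 / 2)"
  proof (rule prod.cong)
    fix i assume "i \<in> {..<n}"
    moreover have "X i -` {xs ! i} \<inter> space M = {\<omega> \<in> space M. X i \<omega> = xs ! i}" by auto
    ultimately show "prob (X i -` {xs ! i} \<inter> space M) = 1 / 2" using prob_X[OF el, of i i] by simp
  qed simp
  also have "\<dots> = 1 / 2 ^ n" by (simp add: power_one_over)
  finally show ?thesis .
qed

text \<open>Transfers counting to the walk: off a null set the increments form one of the coin
  sequences, and each of these has probability \<open>1 / 2 ^ n\<close>.\<close>

lemma prob_coin:
  "prob {\<omega> \<in> space M. P (map (\<lambda>i. X i \<omega>) [0..<n])} = coin_prob n P"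
proof -
  define E where "E = (\<lambda>xs. {\<omega> \<in> space M. map (\<lambda>i. X i \<omega>) [0..<n] = xs})"
  have E: "E xs \<in> sets M" for xs unfolding E_def by measurable
  have "prob {\<omega> \<in> space M. P (map (\<lambda>i. X i \<omega>) [0..<n])} = prob (\<Union>xs\<in>{xs \<in> coin_lists n. P xs}. E xs)"
  proof (rule finite_measure_eq_AE)
    show "AE x in M. (x \<in> {\<omega> \<in> space M. P (map (\<lambda>i. X i \<omega>) [0..<n])}) = (x \<in> (\<Union>xs\<in>{xs \<in> coin_lists n. P xs}. E xs))"
      using AE_X by (auto elim!: eventually_mono simp: E_def coin_lists_def)
    show "(\<Union>xs\<in>{xs \<in> coin_lists n. P xs}. E xs) \<in> sets M"
      using finite_coin_lists[of n] by (intro sets.finite_UN E) auto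
    show "{\<omega> \<in> space M. P (map (\<lambda>i. X i \<omega>) [0..<n])} \<in> sets M"
      by measurable
  qed
  also have "\<dots> = (\<Sum>xs\<in>{xs \<in> coin_lists n. P xs}. prob (E xs))"
    using finite_coin_lists[of n] E
    by (intro finite_measure_finite_Union) (auto simp: disjoint_family_on_def E_def)
  also have "\<dots> = (\<Sum>xs\<in>{xs \<in> coin_lists n. P xs}. 1 / 2 ^ n)"
    by (intro sum.cong) (auto simp: E_def prob_X_list)
  finally show ?thesis by (simp add: coin_prob_def)
qed

section \<open>Measurability and probability of avalanche events\<close>

lemma S_measurable [measurable]: "S n \<in> measurable M (count_space UNIV)"
proof (induction n)
  case 0
  have "(\<lambda>_. 0) \<in> measurable M (count_space (UNIV :: int set))" by simp
  then show ?case using start by (subst measurable_cong[where g = "\<lambda>_. 0"]) auto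
next
  case (Suc n)
  have 1: "(\<lambda>\<omega>. x + X n \<omega>) \<in> measurable M (count_space UNIV)" for x
    by (rule measurable_compose[OF X_measurable]) simp
  have "(\<lambda>\<omega>. (\<lambda>x \<omega>. x + X n \<omega>) (S n \<omega>) \<omega>) \<in> measurable M (count_space UNIV)"
    by (rule measurable_compose_countable[OF 1 Suc])
  then show ?case by (simp add: X_def)
qed

lemma order_volume_measurable [measurable]:
  "(\<lambda>\<omega>. order_volume m (\<lambda>i. S i \<omega>) n u) \<in> measurable M (count_space UNIV)"
proof (induction n arbitrary: u)
  case (Suc n)
  note [measurable] = Suc
  show ?case by simp
qed simp

lemma trade_measurable [measurable]:
  "Measurable.pred M (\<lambda>\<omega>. 0 < order_volume m (\<lambda>i. S i \<omega>) n (S n \<omega>))"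
  by (rule measurable_compose_countable[OF _ S_measurable[of n], of "\<lambda>u \<omega>. 0 < order_volume m (\<lambda>i. S i \<omega>) n u"]) measurable

definition trade :: "nat \<Rightarrow> 'a \<Rightarrow> nat \<Rightarrow> bool" where
  "trade m \<omega> n \<longleftrightarrow> 0 < order_volume m (\<lambda>i. S i \<omega>) n (S n \<omega>)"

lemma avalanche_at_measurable [measurable]:
  "Measurable.pred M (\<lambda>\<omega>. avalanche_at w j (trade m \<omega>))"
  unfolding avalanche_at_def trade_def by measurable

lemma prob_avalanche_at:
  assumes m: "m \<ge> 1"
  shows "prob {\<omega> \<in> space M. avalanche_at w j (trade m \<omega>)} = avalanche_prob m w j"
proof -
  let ?l = "\<lambda>n \<omega>. map (\<lambda>i. X i \<omega>) [0..<n]"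
  have "prob {\<omega> \<in> space M. avalanche_at w j (trade m \<omega>)} =
    prob {\<omega> \<in> space M. avalanche_at w j (\<lambda>r. gap m (take r (?l (j + w) \<omega>)) = 0)}"
  proof (rule finite_measure_eq_AE)
    show "AE \<omega> in M. (\<omega> \<in> {\<omega> \<in> space M. avalanche_at w j (trade m \<omega>)}) =
        (\<omega> \<in> {\<omega> \<in> space M. avalanche_at w j (\<lambda>r. gap m (take r (?l (j + w) \<omega>)) = 0)})"
      using AE_X AE_space
    proof eventually_elim
      case (elim \<omega>)
      have "trade m \<omega> r = (gap m (take r (?l (j + w) \<omega>)) = 0)" if "r \<le> j + w" for r
      proof -
        have "\<bar>S (Suc n) \<omega> - S n \<omega>\<bar> = 1" for n using elim(1)[rule_format, of n] by (auto simp: X_def)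
        then have "trade m \<omega> r \<longleftrightarrow> gap m (map (\<lambda>i. S (Suc i) \<omega> - S i \<omega>) [0..<r]) = 0"
          unfolding trade_def using m start[OF elim(2)] by (intro trade_iff_gap) auto
        moreover have "take r (?l (j + w) \<omega>) = map (\<lambda>i. S (Suc i) \<omega> - S i \<omega>) [0..<r]"
          using that by (simp add: take_map take_upt X_def)
        ultimately show ?thesis by simp
      qed
      then have "avalanche_at w j (trade m \<omega>) = avalanche_at w j (\<lambda>r. gap m (take r (?l (j + w) \<omega>)) = 0)"
        by (rule avalanche_at_cong)
      then show ?case by simp
    qed
  qed measurable
  also have "\<dots> = avalanche_prob m w j"
    unfolding avalanche_prob_def by (rule prob_coin[where P = "\<lambda>xs. avalanche_at w j (\<lambda>r. gap m (take r xs) = 0)"])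
  finally show ?thesis .
qed

text \<open>The events are disjoint, and at \<open>q = 1\<close> their generating function is
  \<open>tail_prob m w / (1 - (1 - tail_prob m w)) = 1\<close>.\<close>

lemma AE_avalanche_at:
  assumes m: "m \<ge> 1" shows "AE \<omega> in M. \<exists>j. avalanche_at w j (trade m \<omega>)"
proof -
  have "(\<lambda>j. prob {\<omega> \<in> space M. avalanche_at w j (trade m \<omega>)}) sums
      prob (\<Union>j. {\<omega> \<in> space M. avalanche_at w j (trade m \<omega>)})"
    by (rule finite_measure_UNION) (auto simp: disjoint_family_on_def dest: avalanche_at_unique)
  moreover have "(\<lambda>j. prob {\<omega> \<in> space M. avalanche_at w j (trade m \<omega>)}) sums 1"
    using avalanche_prob_sums[OF m, of 1 w] tail_prob_pos[OF m, of w]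
    by (simp only: power_one mult_1 sum_tail_prob[OF m] prob_avalanche_at[OF m]) simp
  ultimately have "prob (\<Union>j. {\<omega> \<in> space M. avalanche_at w j (trade m \<omega>)}) = 1" by (rule sums_unique2)
  also have "(\<Union>j. {\<omega> \<in> space M. avalanche_at w j (trade m \<omega>)}) = {\<omega> \<in> space M. \<exists>j. avalanche_at w j (trade m \<omega>)}"
    by auto
  finally show ?thesis by (subst (asm) prob_Collect_eq_1) auto
qed

text \<open>At most one \<open>j\<close> satisfies \<open>avalanche_at\<close>, so the power is a
  series with a single nonzero term. In this form it is measurable and can be integrated term by
  term.\<close>

lemma full_avalanche_length_power:
  assumes "\<omega> \<in> space M"
  shows "q ^ full_avalanche_length m w (\<lambda>i. S i \<omega>) =
    (if \<exists>j. avalanche_at w j (trade m \<omega>) then (\<Sum>j. if avalanche_at w j (trade m \<omega>) then q ^ j else 0) else (1 :: real))"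
proof (cases "\<exists>j. avalanche_at w j (trade m \<omega>)")
  case True
  then obtain j where j: "avalanche_at w j (trade m \<omega>)" by blast
  then have "full_avalanche_length m w (\<lambda>i. S i \<omega>) = j"
    using assms start by (intro full_avalanche_length_eq) (auto simp: trade_def[abs_def])
  moreover have "(\<Sum>j. if avalanche_at w j (trade m \<omega>) then q ^ j else 0) = (\<Sum>k\<in>{j}. if avalanche_at w k (trade m \<omega>) then q ^ k else 0)"
    by (rule suminf_finite) (auto dest: avalanche_at_unique[OF j])
  ultimately show ?thesis using j True by simp
next
  case False
  then have "full_avalanche_length m w (\<lambda>i. S i \<omega>) = 0"
    using assms start by (intro full_avalanche_length_none) (auto simp: trade_def[abs_def])
  then show ?thesis using False by simp
qed

theorem laplace_full_avalanche_length:
  assumes m: "m \<ge> 1" and \<theta>: "\<theta> \<ge> 0"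
  shows "(\<integral>\<omega>. exp (- \<theta> * real (full_avalanche_length m w (\<lambda>i. S i \<omega>))) \<partial>M) =
    tail_prob m w / (1 - (\<Sum>i\<in>{1..w}. exp (- \<theta>) ^ i * (tail_prob m (i - 1) - tail_prob m i)))"
proof -
  define q where "q = exp (- \<theta>)"
  have q: "0 \<le> q" "q \<le> 1" using \<theta> by (auto simp: q_def)
  define f where "f = (\<lambda>j \<omega>. if avalanche_at w j (trade m \<omega>) then q ^ j else 0)"
  have f_ind: "f j \<omega> = q ^ j * indicator {\<omega> \<in> space M. avalanche_at w j (trade m \<omega>)} \<omega>" if "\<omega> \<in> space M" for j \<omega>
    using that by (simp add: f_def)
  have f_int: "(\<integral>\<omega>. f j \<omega> \<partial>M) = q ^ j * avalanche_prob m w j" for j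
    by (subst Bochner_Integration.integral_cong[OF refl f_ind]) (simp_all add: prob_avalanche_at[OF m])
  have f_integrable: "integrable M (f j)" for j
    by (subst Bochner_Integration.integrable_cong[OF refl f_ind])
      (auto intro!: integrable_real_indicator simp: emeasure_eq_measure)
  have f_nonneg: "0 \<le> f j \<omega>" for j \<omega> using q by (simp add: f_def)
  have sums: "(\<lambda>j. q ^ j * avalanche_prob m w j) sums
    (tail_prob m w / (1 - (\<Sum>i\<in>{1..w}. q ^ i * (tail_prob m (i - 1) - tail_prob m i))))"
    by (rule avalanche_prob_sums[OF m q])
  have "summable (\<lambda>j. f j \<omega>)" for \<omega>
  proof (cases "\<exists>j. avalanche_at w j (trade m \<omega>)")
    case True
    then obtain j where j: "avalanche_at w j (trade m \<omega>)" by blast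
    show ?thesis by (rule summable_finite[of "{j}"]) (auto simp: f_def dest: avalanche_at_unique[OF j])
  qed (auto simp: f_def)
  then have "(\<integral>\<omega>. (\<Sum>j. f j \<omega>) \<partial>M) = (\<Sum>j. q ^ j * avalanche_prob m w j)"
    unfolding f_int[symmetric] using f_integrable f_nonneg sums_summable[OF sums]
    by (intro integral_suminf) (auto simp: f_int)
  moreover have "(\<integral>\<omega>. exp (- \<theta> * real (full_avalanche_length m w (\<lambda>i. S i \<omega>))) \<partial>M) = (\<integral>\<omega>. (\<Sum>j. f j \<omega>) \<partial>M)"
  proof -
    have "(\<integral>\<omega>. exp (- \<theta> * real (full_avalanche_length m w (\<lambda>i. S i \<omega>))) \<partial>M) =
      (\<integral>\<omega>. (if \<exists>j. avalanche_at w j (trade m \<omega>) then (\<Sum>j. f j \<omega>) else 1) \<partial>M)"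
    proof (rule Bochner_Integration.integral_cong[OF refl])
      fix \<omega> assume \<omega>: "\<omega> \<in> space M"
      have "exp (- \<theta> * real (full_avalanche_length m w (\<lambda>i. S i \<omega>))) = q ^ full_avalanche_length m w (\<lambda>i. S i \<omega>)"
        by (simp add: q_def exp_of_nat_mult[symmetric] mult.commute)
      then show "exp (- \<theta> * real (full_avalanche_length m w (\<lambda>i. S i \<omega>))) =
          (if \<exists>j. avalanche_at w j (trade m \<omega>) then (\<Sum>j. f j \<omega>) else 1)"
        unfolding f_def using full_avalanche_length_power[OF \<omega>] by simp
    qed
    \<comment> \<open>The branch with value 1, which is \<open>q ^ 0\<close>, lies in the null event
      excluded by \<open>AE_avalanche_at\<close>.\<close>
    also have "\<dots> = (\<integral>\<omega>. (\<Sum>j. f j \<omega>) \<partial>M)"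
    proof (rule integral_cong_AE)
      have [measurable]: "f j \<in> borel_measurable M" for j using f_integrable by auto
      show "(\<lambda>\<omega>. if \<exists>j. avalanche_at w j (trade m \<omega>) then \<Sum>j. f j \<omega> else 1) \<in> borel_measurable M" by measurable
      show "(\<lambda>\<omega>. \<Sum>j. f j \<omega>) \<in> borel_measurable M" by measurable
      show "AE \<omega> in M. (if \<exists>j. avalanche_at w j (trade m \<omega>) then \<Sum>j. f j \<omega> else 1) = (\<Sum>j. f j \<omega>)"
        using AE_avalanche_at[OF m, of w] by eventually_elim simp
    qed
    finally show ?thesis .
  qed
  ultimately show ?thesis using sums_unique[OF sums] by (simp add: q_def)
qed

end

section \<open>The scaling limit of the tail\<close>

text \<open>The \<open>H\<close> of the overview. The image at distance
  \<open>j * (2 * m + 1)\<close>, about \<open>2 * j * \<mu> * sqrt n\<close>, contributes a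
  Gaussian weight with exponent \<open>- 2 * j\<^sup>2 * \<mu>\<^sup>2 / t\<close>.\<close>

definition scaled_tail :: "real \<Rightarrow> real \<Rightarrow> real" where
  "scaled_tail \<mu> t = sqrt (2 / pi) * (2 * (\<Sum>j. (-1) ^ j * exp (- (2 * (real j)\<^sup>2 * \<mu>\<^sup>2 / t))) - 1) / sqrt t"

lemma floor_scaled_tendsto:
  fixes a :: "nat \<Rightarrow> real"
  assumes a: "filterlim a at_top sequentially" and c: "c \<ge> 0"
  shows "(\<lambda>n. real (nat \<lfloor>c * a n\<rfloor>) / a n) \<longlonglongrightarrow> c"
proof (rule tendsto_sandwich)
  have pos: "\<forall>\<^sub>F n in sequentially. 0 < a n" by (rule eventually_compose_filterlim[OF eventually_gt_at_top a])
  show "\<forall>\<^sub>F n in sequentially. c - 1 / a n \<le> real (nat \<lfloor>c * a n\<rfloor>) / a n"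
    using pos
  proof eventually_elim
    case (elim n)
    have "c * a n - 1 \<le> real (nat \<lfloor>c * a n\<rfloor>)" by linarith
    then have "(c * a n - 1) / a n \<le> real (nat \<lfloor>c * a n\<rfloor>) / a n"
      using elim by (intro divide_right_mono) auto
    then show ?case using elim by (simp add: diff_divide_distrib)
  qed
  show "\<forall>\<^sub>F n in sequentially. real (nat \<lfloor>c * a n\<rfloor>) / a n \<le> c"
    using pos
  proof eventually_elim
    case (elim n)
    have "0 \<le> c * a n" using elim c by simp
    then have "real (nat \<lfloor>c * a n\<rfloor>) \<le> c * a n" by linarith
    then show ?case using elim by (simp add: field_simps)
  qed
  have "(\<lambda>n. 1 / a n) \<longlonglongrightarrow> 0"
    by (rule tendsto_divide_0[OF tendsto_const filterlim_at_top_imp_at_infinity[OF a]])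
  then show "(\<lambda>n. c - 1 / a n) \<longlonglongrightarrow> c" using tendsto_diff[OF tendsto_const[of c]] by fastforce
qed simp

abbreviation spread :: "real \<Rightarrow> nat \<Rightarrow> nat" where
  "spread \<mu> n \<equiv> nat \<lfloor>\<mu> * sqrt (real n)\<rfloor>"

abbreviation horizon :: "real \<Rightarrow> nat \<Rightarrow> nat" where
  "horizon s n \<equiv> nat \<lfloor>s * real n\<rfloor>"

lemma sqrt_real_at_top: "filterlim (\<lambda>n. sqrt (real n)) at_top sequentially"
  by (intro filterlim_compose[OF sqrt_at_top] filterlim_real_sequentially)

lemma horizon_at_top: "s > 0 \<Longrightarrow> filterlim (horizon s) at_top sequentially"
  by (intro filterlim_compose[OF filterlim_nat_sequentially] filterlim_compose[OF filterlim_floor_sequentially]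
    filterlim_tendsto_pos_mult_at_top[OF tendsto_const] filterlim_real_sequentially)

lemma eventually_spread: "\<mu> > 0 \<Longrightarrow> \<forall>\<^sub>F n in sequentially. spread \<mu> n \<ge> 1"
proof -
  assume \<mu>: "\<mu> > 0"
  have "filterlim (\<lambda>n. \<mu> * sqrt (real n)) at_top sequentially"
    by (rule filterlim_tendsto_pos_mult_at_top[OF tendsto_const \<mu> sqrt_real_at_top])
  then have "\<forall>\<^sub>F n in sequentially. 1 \<le> \<mu> * sqrt (real n)"
    by (rule eventually_compose_filterlim[OF eventually_ge_at_top])
  then show ?thesis by eventually_elim linarith
qed

text \<open>Each image has its own local limit, with \<open>y = 2 * j * \<mu> / sqrt s\<close>; as
  the weights decrease in \<open>j\<close>, the alternating series converges with them.\<close>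

lemma tail_prob_tendsto:
  assumes \<mu>: "\<mu> > 0" and s: "s > 0"
  shows "(\<lambda>n. sqrt (real n) * tail_prob (spread \<mu> n) (horizon s n)) \<longlonglongrightarrow> scaled_tail \<mu> s"
proof -
  define m l N where "m = spread \<mu>" and "l = horizon s" and "N = (\<lambda>n. 2 * spread \<mu> n + 1)"
  have l: "filterlim l at_top sequentially" unfolding l_def by (rule horizon_at_top[OF s])
  have lpos: "\<forall>\<^sub>F n in sequentially. 0 < l n" by (rule eventually_compose_filterlim[OF eventually_gt_at_top l])
  have ln: "(\<lambda>n. real (l n) / real n) \<longlonglongrightarrow> s"
    unfolding l_def using s by (intro floor_scaled_tendsto filterlim_real_sequentially) simp
  have mn: "(\<lambda>n. real (m n) / sqrt (real n)) \<longlonglongrightarrow> \<mu>"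
    unfolding m_def using \<mu> by (intro floor_scaled_tendsto sqrt_real_at_top) simp
  have sl: "(\<lambda>n. sqrt (real n) / sqrt (real (l n))) \<longlonglongrightarrow> 1 / sqrt s"
  proof -
    have "(\<lambda>n. inverse (sqrt (real (l n) / real n))) \<longlonglongrightarrow> inverse (sqrt s)"
      using s by (intro tendsto_inverse tendsto_real_sqrt ln) simp
    then show ?thesis by (simp add: real_sqrt_divide inverse_eq_divide)
  qed
  have i0: "(\<lambda>n. 1 / sqrt (real n)) \<longlonglongrightarrow> 0"
    by (rule tendsto_divide_0[OF tendsto_const filterlim_at_top_imp_at_infinity[OF sqrt_real_at_top]])
  have npos: "\<forall>\<^sub>F n::nat in sequentially. 0 < n" by (rule eventually_gt_at_top)
  have x: "(\<lambda>n. real (j * N n) / sqrt (real (l n))) \<longlonglongrightarrow> real j * (2 * \<mu> + 0) * (1 / sqrt s)" for j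
  proof -
    have "(\<lambda>n. real j * (2 * (real (m n) / sqrt (real n)) + 1 / sqrt (real n)) *
        (sqrt (real n) / sqrt (real (l n)))) \<longlonglongrightarrow> real j * (2 * \<mu> + 0) * (1 / sqrt s)"
      by (intro tendsto_intros mn i0 sl)
    moreover have "\<forall>\<^sub>F n in sequentially. real j * (2 * (real (m n) / sqrt (real n)) + 1 / sqrt (real n)) *
        (sqrt (real n) / sqrt (real (l n))) = real (j * N n) / sqrt (real (l n))"
      using npos lpos by eventually_elim (simp add: N_def m_def field_simps)
    ultimately show ?thesis by (rule Lim_transform_eventually)
  qed
  define e where "e = (\<lambda>j. exp (- (2 * (real j)\<^sup>2 * \<mu>\<^sup>2 / s)))"
  have a: "(\<lambda>n. sqrt (real (l n)) * binw (l n) (j * N n)) \<longlonglongrightarrow> sqrt (2 / pi) * e j" for j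
  proof -
    have "(real j * (2 * \<mu> + 0) * (1 / sqrt s))\<^sup>2 = 4 * (real j)\<^sup>2 * \<mu>\<^sup>2 / s"
      using s by (simp add: power_mult_distrib power_divide field_simps)
    then show ?thesis using binw_tendsto[OF l x, of j] by (simp add: e_def mult_ac)
  qed
  have e0: "(\<lambda>j. sqrt (2 / pi) * e j) \<longlonglongrightarrow> 0"
    unfolding e_def using \<mu> s by real_asymp
  have Npos: "N n > 0" for n by (simp add: N_def)
  have "(\<lambda>n. \<Sum>j. (-1) ^ j * (sqrt (real (l n)) * binw (l n) (j * N n))) \<longlonglongrightarrow> (\<Sum>j. (-1) ^ j * (sqrt (2 / pi) * e j))"
  proof (rule alternating_suminf_tendsto)
    fix n show "(\<lambda>j. sqrt (real (l n)) * binw (l n) (j * N n)) \<longlonglongrightarrow> 0"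
      using tendsto_mult[OF tendsto_const binw_images_tendsto_0[OF Npos[of n], of "l n"]] by fastforce
  qed (use a e0 in \<open>auto simp: binw_nonneg intro!: mult_left_mono binw_antimono\<close>)
  moreover have "summable (\<lambda>j. (-1) ^ j * binw (l n) (j * N n))" for n
    using Npos[of n] by (intro summable_Leibniz'(1) binw_images_tendsto_0 binw_antimono) (auto simp: binw_nonneg)
  then have "(\<Sum>j. (-1) ^ j * (sqrt (real (l n)) * binw (l n) (j * N n))) =
      sqrt (real (l n)) * (\<Sum>j. (-1) ^ j * binw (l n) (j * N n))" for n
    by (subst suminf_mult[symmetric]) (simp_all add: mult_ac)
  moreover have e_dec: "e (Suc j) \<le> e j" for j
    unfolding e_def using s by (auto intro!: divide_right_mono mult_mono)
  have "e \<longlonglongrightarrow> 0" unfolding e_def using \<mu> s by real_asymp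
  then have "summable (\<lambda>j. (-1) ^ j * e j)" by (rule summable_Leibniz'(1)) (auto simp: e_dec, simp add: e_def)
  then have "(\<Sum>j. (-1) ^ j * (sqrt (2 / pi) * e j)) = sqrt (2 / pi) * (\<Sum>j. (-1) ^ j * e j)"
    by (subst suminf_mult[symmetric]) (simp_all add: mult_ac)
  ultimately have L1: "(\<lambda>n. sqrt (real (l n)) * (\<Sum>j. (-1) ^ j * binw (l n) (j * N n))) \<longlonglongrightarrow>
      sqrt (2 / pi) * (\<Sum>j. (-1) ^ j * e j)" by simp
  have L2: "(\<lambda>n. sqrt (real (l n)) * binw (l n) 0) \<longlonglongrightarrow> sqrt (2 / pi)"
    using a[of 0] by (simp add: e_def)
  have "(\<lambda>n. (2 * (sqrt (real (l n)) * (\<Sum>j. (-1) ^ j * binw (l n) (j * N n))) - sqrt (real (l n)) * binw (l n) 0)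
      * (sqrt (real n) / sqrt (real (l n)))) \<longlonglongrightarrow>
      (2 * (sqrt (2 / pi) * (\<Sum>j. (-1) ^ j * e j)) - sqrt (2 / pi)) * (1 / sqrt s)"
    by (rule tendsto_mult[OF tendsto_diff[OF tendsto_mult[OF tendsto_const L1] L2] sl])
  moreover have "\<forall>\<^sub>F n in sequentially. (2 * (sqrt (real (l n)) * (\<Sum>j. (-1) ^ j * binw (l n) (j * N n))) - sqrt (real (l n)) * binw (l n) 0)
      * (sqrt (real n) / sqrt (real (l n))) = sqrt (real n) * tail_prob (m n) (l n)"
    using lpos eventually_spread[OF \<mu>]
  proof eventually_elim
    case (elim n)
    then have tp: "tail_prob (m n) (l n) = 2 * (\<Sum>j. (-1) ^ j * binw (l n) (j * N n)) - binw (l n) 0"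
      using surv_images[of "N n" "l n"] by (simp add: tail_prob_def N_def m_def)
    show ?case unfolding tp using elim by (simp add: field_simps)
  qed
  ultimately have "(\<lambda>n. sqrt (real n) * tail_prob (m n) (l n)) \<longlonglongrightarrow>
      (2 * (sqrt (2 / pi) * (\<Sum>j. (-1) ^ j * e j)) - sqrt (2 / pi)) * (1 / sqrt s)"
    by (rule Lim_transform_eventually)
  also have "(2 * (sqrt (2 / pi) * (\<Sum>j. (-1) ^ j * e j)) - sqrt (2 / pi)) * (1 / sqrt s) = scaled_tail \<mu> s"
    by (simp add: scaled_tail_def e_def right_diff_distrib mult.left_commute)
  finally show ?thesis by (simp add: m_def l_def)
qed

lemma tail_prob_antimono: "m \<ge> 1 \<Longrightarrow> k \<le> l \<Longrightarrow> tail_prob m l \<le> tail_prob m k"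
  by (rule lift_Suc_antimono_le[of "tail_prob m"]) (auto simp: tail_prob_Suc_le)

lemma scaled_tail_antimono:
  assumes "\<mu> > 0" "0 < s" "s \<le> t" shows "scaled_tail \<mu> t \<le> scaled_tail \<mu> s"
proof (rule tendsto_le[OF _ tail_prob_tendsto tail_prob_tendsto])
  show "\<forall>\<^sub>F n in sequentially. sqrt (real n) * tail_prob (spread \<mu> n) (horizon t n) \<le> sqrt (real n) * tail_prob (spread \<mu> n) (horizon s n)"
    using eventually_spread[OF assms(1)]
  proof eventually_elim
    case (elim n)
    have "horizon s n \<le> horizon t n" using assms by (intro nat_mono floor_mono mult_right_mono) auto
    then show ?case using elim by (intro mult_left_mono tail_prob_antimono) auto
  qed
qed (use assms in auto)

text \<open>The \<open>+ 1\<close> in \<open>surv_le\<close> makes up for the floor, since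
  \<open>horizon s n + 1 >= s * n\<close>. The bound is free of \<open>n\<close> and integrable at
  0, so it can dominate.\<close>

lemma tail_prob_le:
  assumes "m \<ge> 1" "s > 0" "n > 0"
  shows "sqrt (real n) * tail_prob m (horizon s n) \<le> 1 / sqrt s"
proof -
  have "tail_prob m (horizon s n) \<le> 1 / sqrt (real (horizon s n) + 1)"
    unfolding tail_prob_def using assms by (intro surv_le) simp
  also have "\<dots> \<le> 1 / sqrt (s * real n)"
  proof -
    have "0 < s * real n" using assms by simp
    moreover have "s * real n \<le> real (horizon s n) + 1" by linarith
    moreover have "0 < real (horizon s n) + 1" by (rule add_nonneg_pos) simp_all
    ultimately show ?thesis
      by (intro divide_left_mono real_sqrt_le_mono mult_pos_pos) (simp_all only: real_sqrt_gt_zero zero_le_one)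
  qed
  finally have "sqrt (real n) * tail_prob m (horizon s n) \<le> sqrt (real n) * (1 / sqrt (s * real n))"
    by (intro mult_left_mono) auto
  also have "\<dots> = 1 / sqrt s" using assms by (simp add: real_sqrt_mult)
  finally show ?thesis .
qed

lemma scaled_tail_le:
  assumes "\<mu> > 0" "s > 0" shows "scaled_tail \<mu> s \<le> 1 / sqrt s"
proof (rule tendsto_upperbound[OF tail_prob_tendsto])
  show "\<forall>\<^sub>F n in sequentially. sqrt (real n) * tail_prob (spread \<mu> n) (horizon s n) \<le> 1 / sqrt s"
    using eventually_spread[OF assms(1)] eventually_gt_at_top[of 0]
    by eventually_elim (rule tail_prob_le, use assms in auto)
qed (use assms in auto)

section \<open>Positivity of the limiting tail\<close>

text \<open>Averaging multiplies \<open>sin (pi * x / N)\<close> by \<open>cos (pi / N)\<close>. The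
  sine lies below the square wave on the interval and vanishes at both ends, where
  \<open>surv\<close> vanishes too, so the comparison survives every step.\<close>

lemma surv_ge_eigenfunction:
  assumes N: "N > 0" and x: "0 \<le> x" "x \<le> N"
  shows "cos (pi / N) ^ n * sin (pi * x / N) \<le> surv N n x"
  using x
proof (induction n arbitrary: x)
  case 0
  consider "x = 0" | "x = N" | "0 < x" "x < N" using 0 by linarith
  then show ?case using N by cases (simp_all add: wave_def wave_small[unfolded wave_def])
next
  case (Suc n)
  consider "x = 0" | "x = N" | "0 < x" "x < N" using Suc.prems by linarith
  then show ?case
  proof cases
    case 1
    then show ?thesis using surv_zero[OF N, of "Suc n"] by (simp del: surv.simps)
  next
    case 2
    have "surv N (Suc n) N = 0" using surv_add[OF N, of "Suc n" 0] surv_zero[OF N, of "Suc n"] by (simp del: surv.simps)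
    then show ?thesis using 2 N by (simp del: surv.simps)
  next
    case 3
    have e1: "pi * of_int (x - 1) / of_int N = pi * of_int x / of_int N - pi / of_int N"
      and e2: "pi * of_int (x + 1) / of_int N = pi * of_int x / of_int N + pi / of_int N"
      by (simp_all add: algebra_simps diff_divide_distrib add_divide_distrib)
    have "sin (pi * of_int (x - 1) / of_int N) + sin (pi * of_int (x + 1) / of_int N)
      = 2 * cos (pi / of_int N) * sin (pi * of_int x / of_int N)"
      unfolding e1 e2 sin_add sin_diff by simp
    then have "cos (pi / N) ^ Suc n * sin (pi * x / N) =
        (cos (pi / N) ^ n * sin (pi * of_int (x - 1) / N) + cos (pi / N) ^ n * sin (pi * of_int (x + 1) / N)) / 2"
      by (simp only: distrib_left[symmetric]) simp
    also have "\<dots> \<le> (surv N n (x - 1) + surv N n (x + 1)) / 2"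
      using Suc.IH[of "x - 1"] Suc.IH[of "x + 1"] 3 by (intro divide_right_mono add_mono) auto
    finally show ?thesis by simp
  qed
qed

lemma tail_prob_ge: "cos (pi / real (2 * m + 1)) ^ n * sin (pi / real (2 * m + 1)) \<le> tail_prob m n"
  using surv_ge_eigenfunction[of "int (2 * m + 1)" 1 n] by (simp add: tail_prob_def)

text \<open>Turns the power of the cosine into an exponential with a limit. The exponent is twice
  the true leading order \<open>y\<^sup>2 / 2\<close>; this leaves room for
  \<open>1 / (1 + y\<^sup>2) \<le> 1 - y\<^sup>2 / 2\<close>, valid for \<open>y \<le> 1\<close>,
  and positivity of the limit is all that is asked for.\<close>

lemma cos_ge_exp:
  fixes y :: real assumes "0 \<le> y" "y \<le> 1" shows "exp (- y\<^sup>2) \<le> cos y"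
proof -
  have "sin (y / 2) \<le> y / 2" using assms by (intro sin_x_le_x) simp
  moreover have "0 \<le> sin (y / 2)" using assms pi_gt3 by (intro sin_ge_zero) auto
  ultimately have "(sin (y / 2))\<^sup>2 \<le> (y / 2)\<^sup>2" by (intro power_mono)
  then have 1: "1 - y\<^sup>2 / 2 \<le> cos y" using cos_double_sin[of "y / 2"] by (simp add: power_divide)
  have y2: "0 \<le> y\<^sup>2" "y\<^sup>2 \<le> 1" using assms by (auto simp: power_le_one)
  have "exp (- y\<^sup>2) = inverse (exp (y\<^sup>2))" by (simp add: exp_minus)
  also have "\<dots> \<le> inverse (1 + y\<^sup>2)" using y2 by (intro le_imp_inverse_le) (auto intro: add_pos_nonneg)
  also have "\<dots> \<le> 1 - y\<^sup>2 / 2"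
  proof -
    have "1 \<le> (1 - y\<^sup>2 / 2) * (1 + y\<^sup>2)" using mult_left_le[of "y\<^sup>2" "y\<^sup>2"] y2 by (simp add: algebra_simps)
    moreover have "0 < 1 + y\<^sup>2" using y2 by linarith
    ultimately have "1 / (1 + y\<^sup>2) \<le> 1 - y\<^sup>2 / 2" by (simp only: pos_divide_le_eq)
    then show ?thesis by (simp add: inverse_eq_divide)
  qed
  finally show ?thesis using 1 by linarith
qed

lemma scaled_tail_pos:
  assumes \<mu>: "\<mu> > 0" and s: "s > 0" shows "0 < scaled_tail \<mu> s"
proof -
  define y where "y = (\<lambda>n. pi / real (2 * spread \<mu> n + 1))"
  have i0: "(\<lambda>n. 1 / sqrt (real n)) \<longlonglongrightarrow> 0"
    by (rule tendsto_divide_0[OF tendsto_const filterlim_at_top_imp_at_infinity[OF sqrt_real_at_top]])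
  have mn: "(\<lambda>n. real (spread \<mu> n) / sqrt (real n)) \<longlonglongrightarrow> \<mu>"
    using \<mu> by (intro floor_scaled_tendsto sqrt_real_at_top) simp
  have ln: "(\<lambda>n. real (horizon s n) / real n) \<longlonglongrightarrow> s"
    using s by (intro floor_scaled_tendsto filterlim_real_sequentially) simp
  have "(\<lambda>n. pi / (2 * (real (spread \<mu> n) / sqrt (real n)) + 1 / sqrt (real n))) \<longlonglongrightarrow> pi / (2 * \<mu> + 0)"
    using \<mu> by (intro tendsto_intros mn i0) simp
  moreover have "\<forall>\<^sub>F n in sequentially. pi / (2 * (real (spread \<mu> n) / sqrt (real n)) + 1 / sqrt (real n)) = sqrt (real n) * y n"
    using eventually_gt_at_top[of 0] by eventually_elim (simp add: y_def field_simps)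
  ultimately have ny: "(\<lambda>n. sqrt (real n) * y n) \<longlonglongrightarrow> pi / (2 * \<mu> + 0)"
    by (rule Lim_transform_eventually)
  have y_pos: "y n > 0" for n by (simp add: y_def)
  then have y_ne: "y n \<noteq> 0" for n using less_imp_neq[of 0 "y n"] by metis
  have "(\<lambda>n. sqrt (real n) * y n * (1 / sqrt (real n))) \<longlonglongrightarrow> pi / (2 * \<mu> + 0) * 0"
    by (intro tendsto_mult ny i0)
  moreover have "\<forall>\<^sub>F n in sequentially. sqrt (real n) * y n * (1 / sqrt (real n)) = y n"
    using eventually_gt_at_top[of 0] by eventually_elim simp
  ultimately have y0: "y \<longlonglongrightarrow> 0" using Lim_transform_eventually by fastforce
  have "filterlim y (at_right 0) sequentially"
    unfolding filterlim_at using y0 y_ne by (simp add: y_pos)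
  moreover have "((\<lambda>x::real. sin x / x) \<longlongrightarrow> 1) (at_right 0)" by real_asymp
  ultimately have siny: "(\<lambda>n. sin (y n) / y n) \<longlonglongrightarrow> 1" by (rule filterlim_compose[rotated])
  \<comment> \<open>Lower bound for the scaled tail, arranged in convergent factors:
    \<open>y\<close> is of order \<open>1 / sqrt n\<close>, so \<open>sin y\<close> absorbs the
    factor \<open>sqrt n\<close>, and the exponent \<open>l * y\<^sup>2\<close> is
    \<open>(l / n) * (sqrt n * y)\<^sup>2\<close>.\<close>
  define b where "b = (\<lambda>n. sqrt (real n) * y n * (sin (y n) / y n) * exp (- (real (horizon s n) / real n * (sqrt (real n) * y n)\<^sup>2)))"
  have b: "b \<longlonglongrightarrow> pi / (2 * \<mu> + 0) * 1 * exp (- (s * (pi / (2 * \<mu> + 0))\<^sup>2))"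
    unfolding b_def by (intro tendsto_intros ny siny ln)
  have "pi / (2 * \<mu> + 0) * 1 * exp (- (s * (pi / (2 * \<mu> + 0))\<^sup>2)) \<le> scaled_tail \<mu> s"
  proof (rule tendsto_le[OF _ tail_prob_tendsto[OF \<mu> s] b])
    have "\<forall>\<^sub>F n in sequentially. y n < 1" using y0 by (rule order_tendstoD) simp
    then show "\<forall>\<^sub>F n in sequentially. b n \<le> sqrt (real n) * tail_prob (spread \<mu> n) (horizon s n)"
      using eventually_gt_at_top[of 0]
    proof eventually_elim
      case (elim n)
      define l where "l = horizon s n"
      have yle: "0 \<le> y n" "y n \<le> 1" using elim y_pos[of n] by auto
      have "b n = sqrt (real n) * (exp (- (y n)\<^sup>2) ^ l * sin (y n))"
        using elim y_pos[of n]
        by (simp add: b_def l_def power_mult_distrib exp_of_nat_mult[symmetric])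
      also have "\<dots> \<le> sqrt (real n) * (cos (y n) ^ l * sin (y n))"
        using yle pi_gt3 by (intro mult_left_mono mult_right_mono power_mono cos_ge_exp sin_ge_zero) auto
      also have "\<dots> \<le> sqrt (real n) * tail_prob (spread \<mu> n) l"
        unfolding y_def by (intro mult_left_mono tail_prob_ge) simp
      finally show ?case by (simp add: l_def)
    qed
  qed simp
  moreover have "0 < pi / (2 * \<mu> + 0) * 1 * exp (- (s * (pi / (2 * \<mu> + 0))\<^sup>2))" using \<mu> by simp
  ultimately show ?thesis by linarith
qed

section \<open>The density of the scaling limit\<close>

definition h_term :: "real \<Rightarrow> nat \<Rightarrow> real \<Rightarrow> real" where
  "h_term \<mu> k x = (-1) ^ k * (1 / sqrt (2 * pi) * x powr (-3/2)
    - 2 * sqrt (2 / pi) * (real k)\<^sup>2 * \<mu>\<^sup>2 * x powr (-5/2)) * exp (- (2 * (real k)\<^sup>2 * \<mu>\<^sup>2 / x))"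

lemma avalanche_h_eq: "avalanche_h \<mu> x = 1 / sqrt (2 * pi) * x powr (-3/2) + 2 * (\<Sum>j. h_term \<mu> (Suc j) x)"
  by (simp add: avalanche_h_def h_term_def Let_def)

lemma sqrt_2_div_pi: "sqrt (2 / pi) = 2 / sqrt (2 * pi)"
proof -
  have "2 / pi = 2\<^sup>2 / (2 * pi)" by (simp add: power2_eq_square)
  then show ?thesis by (simp only: real_sqrt_divide real_sqrt_abs)
qed

lemma DERIV_powr_minus_half:
  assumes "x > 0" shows "((\<lambda>x. x powr (-1/2)) has_real_derivative - (x powr (-3/2) / 2)) (at x within A)"
  using has_field_derivative_at_within[OF has_real_derivative_powr[OF assms, of "-1/2"]] by simp

text \<open>The origin of the two-term bracket in \<open>h\<close>: one term comes from the power
  \<open>x powr (-1/2)\<close>, the other from the exponential.\<close>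

lemma DERIV_image_term:
  assumes x: "x > 0"
  shows "((\<lambda>x. (-1) ^ k * (sqrt (2 / pi) * x powr (-1/2) * exp (- (2 * (real k)\<^sup>2 * \<mu>\<^sup>2 / x))))
    has_real_derivative - h_term \<mu> k x) (at x within A)"
proof -
  define c where "c = 2 * (real k)\<^sup>2 * \<mu>\<^sup>2"
  have p: "x powr (-5/2) = x powr (-1/2) / x\<^sup>2"
    using x powr_diff[of x "-1/2" 2] by simp
  have D: "((\<lambda>x. exp (- (c / x))) has_real_derivative exp (- (c / x)) * (c / x\<^sup>2)) (at x within A)"
    using x by (auto intro!: derivative_eq_intros simp: power2_eq_square)
  have "((\<lambda>x. (-1) ^ k * (sqrt (2 / pi) * x powr (-1/2) * exp (- (c / x)))) has_real_derivative
      (-1) ^ k * (sqrt (2 / pi) * (- (x powr (-3/2) / 2)) * exp (- (c / x)) +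
        sqrt (2 / pi) * x powr (-1/2) * (exp (- (c / x)) * (c / x\<^sup>2)))) (at x within A)"
    by (rule DERIV_cong[OF DERIV_cmult[OF DERIV_mult[OF DERIV_cmult[OF DERIV_powr_minus_half[OF x]] D]]])
      (simp add: mult_ac)
  moreover have "(-1) ^ k * (sqrt (2 / pi) * (- (x powr (-3/2) / 2)) * exp (- (c / x)) +
        sqrt (2 / pi) * x powr (-1/2) * (exp (- (c / x)) * (c / x\<^sup>2))) = - h_term \<mu> k x"
    unfolding h_term_def p c_def[symmetric] sqrt_2_div_pi by (simp add: c_def algebra_simps)
  ultimately show ?thesis by (simp add: c_def)
qed

text \<open>A summable majorant on \<open>{a..b}\<close>. The bracket grows like
  \<open>k\<^sup>2\<close>, and \<open>exp (- y) \<le> 2 / y\<^sup>2\<close> with \<open>y\<close>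
  proportional to \<open>k\<^sup>2\<close> leaves \<open>1 / k\<^sup>2\<close>.\<close>

lemma h_term_bound:
  assumes \<mu>: "\<mu> > 0" and x: "0 < a" "a \<le> x" "x \<le> b" and k: "k \<ge> 1"
  shows "\<bar>h_term \<mu> k x\<bar> \<le> (1 / sqrt (2 * pi) * a powr (-3/2) + 2 * sqrt (2 / pi) * \<mu>\<^sup>2 * a powr (-5/2)) *
    (2 / (2 * \<mu>\<^sup>2 / b)\<^sup>2) * inverse ((real k)\<^sup>2)"
proof -
  define A B c where "A = 1 / sqrt (2 * pi) * a powr (-3/2)" and "B = 2 * sqrt (2 / pi) * \<mu>\<^sup>2 * a powr (-5/2)"
    and "c = 2 * \<mu>\<^sup>2 / b"
  have c: "c > 0" using \<mu> x by (simp add: c_def)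
  have K: "1 \<le> (real k)\<^sup>2" using k by simp
  have AB: "0 \<le> A" "0 \<le> B" by (simp_all add: A_def B_def)
  have "\<bar>1 / sqrt (2 * pi) * x powr (-3/2) - 2 * sqrt (2 / pi) * (real k)\<^sup>2 * \<mu>\<^sup>2 * x powr (-5/2)\<bar>
    \<le> \<bar>1 / sqrt (2 * pi) * x powr (-3/2)\<bar> + \<bar>2 * sqrt (2 / pi) * (real k)\<^sup>2 * \<mu>\<^sup>2 * x powr (-5/2)\<bar>"
    by (rule abs_triangle_ineq4)
  also have "\<dots> = 1 / sqrt (2 * pi) * x powr (-3/2) + 2 * sqrt (2 / pi) * (real k)\<^sup>2 * \<mu>\<^sup>2 * x powr (-5/2)"
    by simp
  also have "\<dots> \<le> A + 2 * sqrt (2 / pi) * (real k)\<^sup>2 * \<mu>\<^sup>2 * a powr (-5/2)"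
    unfolding A_def using x by (intro add_mono mult_left_mono powr_mono2') auto
  also have "\<dots> = A + B * (real k)\<^sup>2" by (simp add: B_def)
  also have "\<dots> \<le> (A + B) * (real k)\<^sup>2" using mult_left_mono[OF K AB(1)] by (simp add: algebra_simps)
  finally have 1: "\<bar>1 / sqrt (2 * pi) * x powr (-3/2) - 2 * sqrt (2 / pi) * (real k)\<^sup>2 * \<mu>\<^sup>2 * x powr (-5/2)\<bar>
    \<le> (A + B) * (real k)\<^sup>2" .
  define y where "y = c * (real k)\<^sup>2"
  have y: "y > 0" using c k by (simp add: y_def)
  have "y \<le> 2 * (real k)\<^sup>2 * \<mu>\<^sup>2 / x"
    using x unfolding y_def c_def by (simp add: frac_le mult_ac)
  then have "exp (- (2 * (real k)\<^sup>2 * \<mu>\<^sup>2 / x)) \<le> exp (- y)" by simp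
  also have "\<dots> = inverse (exp y)" by (simp add: exp_minus)
  also have "\<dots> \<le> inverse (y\<^sup>2 / 2)"
  proof (rule le_imp_inverse_le)
    have "1 + y + y\<^sup>2 / 2 \<le> exp y" using y by (intro exp_lower_Taylor_quadratic) simp
    then show "y\<^sup>2 / 2 \<le> exp y" using y by linarith
  qed (use y in simp)
  finally have 2: "exp (- (2 * (real k)\<^sup>2 * \<mu>\<^sup>2 / x)) \<le> inverse (y\<^sup>2 / 2)" .
  have "\<bar>h_term \<mu> k x\<bar> = \<bar>1 / sqrt (2 * pi) * x powr (-3/2) - 2 * sqrt (2 / pi) * (real k)\<^sup>2 * \<mu>\<^sup>2 * x powr (-5/2)\<bar>
      * exp (- (2 * (real k)\<^sup>2 * \<mu>\<^sup>2 / x))"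
    unfolding h_term_def by (simp only: abs_mult power_abs abs_exp_cancel) simp
  also have "\<dots> \<le> ((A + B) * (real k)\<^sup>2) * inverse (y\<^sup>2 / 2)"
    using AB by (intro mult_mono 1 2) (simp_all only: exp_ge_zero mult_nonneg_nonneg add_nonneg_nonneg zero_le_power2)
  also have "\<dots> = (A + B) * (2 / c\<^sup>2) * inverse ((real k)\<^sup>2)"
    using c k by (simp add: y_def field_simps power2_eq_square)
  finally show ?thesis by (simp add: A_def B_def c_def)
qed

lemma summable_image_weights:
  assumes "\<mu> > 0" "t > 0"
  shows "summable (\<lambda>j. (-1) ^ j * exp (- (2 * (real j)\<^sup>2 * \<mu>\<^sup>2 / t)))"
proof (rule summable_Leibniz'(1))
  show "(\<lambda>j. exp (- (2 * (real j)\<^sup>2 * \<mu>\<^sup>2 / t))) \<longlonglongrightarrow> 0" using assms by real_asymp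
  show "exp (- (2 * (real (Suc j))\<^sup>2 * \<mu>\<^sup>2 / t)) \<le> exp (- (2 * (real j)\<^sup>2 * \<mu>\<^sup>2 / t))" for j
    using assms by (auto intro!: divide_right_mono mult_mono)
qed simp

text \<open>Termwise differentiation of the images with positive index. The one at the origin is
  split off: its derivative is the leading term of \<open>- h\<close>, and the majorant holds for
  \<open>k >= 1\<close>.\<close>

lemma DERIV_scaled_tail:
  assumes \<mu>: "\<mu> > 0" and x: "x > 0"
  shows "(scaled_tail \<mu> has_real_derivative - avalanche_h \<mu> x) (at x)"
proof -
  define u where "u = (\<lambda>j x. (-1) ^ Suc j * (sqrt (2 / pi) * x powr (-1/2) * exp (- (2 * (real (Suc j))\<^sup>2 * \<mu>\<^sup>2 / x))))"
  \<comment> \<open>A compact neighbourhood of \<open>x\<close> away from 0, on which one majorant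
    serves all points.\<close>
  define I where "I = {x / 2..2 * x}"
  have I: "t > 0" "x / 2 \<le> t" "t \<le> 2 * x" if "t \<in> I" for t using that x by (auto simp: I_def)
  have eq: "scaled_tail \<mu> t = sqrt (2 / pi) * t powr (-1/2) + 2 * (\<Sum>j. u j t)"
    and summable_u: "summable (\<lambda>j. u j t)" if t: "t > 0" for t
  proof -
    define e where "e = (\<lambda>j. (-1) ^ j * exp (- (2 * (real j)\<^sup>2 * \<mu>\<^sup>2 / t)))"
    have e: "summable e" unfolding e_def by (rule summable_image_weights[OF \<mu> t])
    have e': "summable (\<lambda>j. e (Suc j))" using e by (subst summable_Suc_iff)
    have p: "t powr (-1/2) = 1 / sqrt t" using t by (simp add: powr_minus_divide powr_half_sqrt)
    have u: "u j t = sqrt (2 / pi) * t powr (-1/2) * e (Suc j)" for j by (simp add: u_def e_def)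
    show "summable (\<lambda>j. u j t)" unfolding u by (intro summable_mult e')
    have "(\<Sum>j. u j t) = sqrt (2 / pi) * t powr (-1/2) * (\<Sum>j. e (Suc j))"
      unfolding u by (intro suminf_mult e')
    moreover have "(\<Sum>j. e j) = (\<Sum>j. e (Suc j)) + 1"
      using suminf_split_head[OF e] by (simp add: e_def)
    ultimately show "scaled_tail \<mu> t = sqrt (2 / pi) * t powr (-1/2) + 2 * (\<Sum>j. u j t)"
      unfolding scaled_tail_def e_def[symmetric] p by (simp add: algebra_simps add_divide_distrib)
  qed
  define K where "K = (1 / sqrt (2 * pi) * (x / 2) powr (-3/2) + 2 * sqrt (2 / pi) * \<mu>\<^sup>2 * (x / 2) powr (-5/2)) *
    (2 / (2 * \<mu>\<^sup>2 / (2 * x))\<^sup>2)"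
  have unif: "uniformly_convergent_on I (\<lambda>n t. \<Sum>j<n. - h_term \<mu> (Suc j) t)"
  proof (rule Weierstrass_m_test')
    show "norm (- h_term \<mu> (Suc j) t) \<le> K * inverse ((real (Suc j))\<^sup>2)" if "t \<in> I" for j t
      unfolding K_def using h_term_bound[OF \<mu>, of "x / 2" t "2 * x" "Suc j"] I[OF that] x by simp
    have "summable (\<lambda>j. inverse ((real j)\<^sup>2))" by (rule inverse_power_summable) simp
    then show "summable (\<lambda>j. K * inverse ((real (Suc j))\<^sup>2))"
      by (intro summable_mult) (subst summable_Suc_iff)
  qed
  have "((\<lambda>t. \<Sum>j. u j t) has_real_derivative (\<Sum>j. - h_term \<mu> (Suc j) x)) (at x)"
  proof (rule has_field_derivative_series'(2)[OF _ _ unif])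
    show "convex I" by (simp add: I_def)
    show "(u j has_real_derivative - h_term \<mu> (Suc j) t) (at t within I)" if "t \<in> I" for j t
      unfolding u_def by (rule DERIV_image_term) (rule I[OF that])
    show "x \<in> I" using x by (simp add: I_def)
    show "summable (\<lambda>j. u j x)" by (rule summable_u[OF x])
    show "x \<in> interior I" using x by (simp add: I_def)
  qed
  then have "((\<lambda>t. sqrt (2 / pi) * t powr (-1/2) + 2 * (\<Sum>j. u j t)) has_real_derivative
      sqrt (2 / pi) * - (x powr (-3/2) / 2) + 2 * (\<Sum>j. - h_term \<mu> (Suc j) x)) (at x)"
    by (intro DERIV_add DERIV_cmult DERIV_powr_minus_half x)
  moreover have "summable (\<lambda>j. h_term \<mu> (Suc j) x)"
  proof (rule summable_comparison_test')
    have "summable (\<lambda>j. inverse ((real j)\<^sup>2))" by (rule inverse_power_summable) simp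
    then show "summable (\<lambda>j. K * inverse ((real (Suc j))\<^sup>2))"
      by (intro summable_mult) (subst summable_Suc_iff)
    show "norm (h_term \<mu> (Suc j) x) \<le> K * inverse ((real (Suc j))\<^sup>2)" if "j \<ge> 0" for j
      unfolding K_def using h_term_bound[OF \<mu>, of "x / 2" x "2 * x" "Suc j"] x by simp
  qed
  then have "sqrt (2 / pi) * - (x powr (-3/2) / 2) + 2 * (\<Sum>j. - h_term \<mu> (Suc j) x) = - avalanche_h \<mu> x"
    by (simp add: avalanche_h_eq suminf_minus sqrt_2_div_pi)
  ultimately have "((\<lambda>t. sqrt (2 / pi) * t powr (-1/2) + 2 * (\<Sum>j. u j t)) has_real_derivative - avalanche_h \<mu> x) (at x)"
    by simp
  then show ?thesis
    by (rule has_field_derivative_transform_within_open[of _ _ _ "{0<..}"]) (use x eq in auto)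
qed

text \<open>The sign is what allows the integrals of \<open>h\<close> to be computed as nonnegative
  integrals, by the fundamental theorem and Tonelli.\<close>

lemma avalanche_h_nonneg:
  assumes "\<mu> > 0" "x > 0" shows "0 \<le> avalanche_h \<mu> x"
proof (rule mono_on_imp_deriv_nonneg)
  show "mono_on {0<..} (\<lambda>x. - scaled_tail \<mu> x)"
    using assms by (intro mono_onI) (auto intro: scaled_tail_antimono)
  show "((\<lambda>x. - scaled_tail \<mu> x) has_real_derivative avalanche_h \<mu> x) (at x)"
    using DERIV_minus[OF DERIV_scaled_tail[OF assms]] by simp
  show "x \<in> interior {0<..}" using assms by (simp add: interior_open)
qed

section \<open>Integrals of the density\<close>

lemma avalanche_h_measurable [measurable]: "avalanche_h \<mu> \<in> borel_measurable borel"
  unfolding avalanche_h_eq[abs_def] h_term_def by measurable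

lemma scaled_tail_measurable [measurable]: "scaled_tail \<mu> \<in> borel_measurable borel"
  unfolding scaled_tail_def[abs_def] by measurable

lemma scaled_tail_tendsto_0:
  assumes "\<mu> > 0" shows "(scaled_tail \<mu> \<longlongrightarrow> 0) at_top"
proof (rule tendsto_sandwich)
  show "\<forall>\<^sub>F s in at_top. 0 \<le> scaled_tail \<mu> s"
    using eventually_gt_at_top[of 0] by eventually_elim (use assms in \<open>auto intro: less_imp_le scaled_tail_pos\<close>)
  show "\<forall>\<^sub>F s in at_top. scaled_tail \<mu> s \<le> 1 / sqrt s"
    using eventually_gt_at_top[of 0] by eventually_elim (use assms in \<open>auto intro: scaled_tail_le\<close>)
  show "((\<lambda>s::real. 1 / sqrt s) \<longlongrightarrow> 0) at_top" by real_asymp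
qed simp

lemma DERIV_minus_scaled_tail:
  assumes "\<mu> > 0" "x > 0" shows "((\<lambda>x. - scaled_tail \<mu> x) has_real_derivative avalanche_h \<mu> x) (at x)"
  using DERIV_minus[OF DERIV_scaled_tail[OF assms]] by simp

lemma integral_avalanche_h_tail:
  assumes \<mu>: "\<mu> > 0" and \<epsilon>: "\<epsilon> > 0"
  shows "(LBINT x:{\<epsilon><..}. avalanche_h \<mu> x) = scaled_tail \<mu> \<epsilon>"
proof -
  have "(LBINT x:{\<epsilon><..}. avalanche_h \<mu> x) = enn2real (\<integral>\<^sup>+x. ennreal (indicator {\<epsilon><..} x *\<^sub>R avalanche_h \<mu> x) \<partial>lborel)"
    unfolding set_lebesgue_integral_def
    using avalanche_h_nonneg[OF \<mu>] \<epsilon> by (intro integral_eq_nn_integral) (auto simp: indicator_def)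
  also have "(\<integral>\<^sup>+x. ennreal (indicator {\<epsilon><..} x *\<^sub>R avalanche_h \<mu> x) \<partial>lborel) =
      (\<integral>\<^sup>+x. ennreal (avalanche_h \<mu> x) * indicator {\<epsilon>..} x \<partial>lborel)"
  proof (rule nn_integral_cong_AE)
    show "AE x in lborel. ennreal (indicator {\<epsilon><..} x *\<^sub>R avalanche_h \<mu> x) = ennreal (avalanche_h \<mu> x) * indicator {\<epsilon>..} x"
      using AE_lborel_singleton[of \<epsilon>] by eventually_elim (auto simp: indicator_def)
  qed
  also have "\<dots> = ennreal (0 - (- scaled_tail \<mu> \<epsilon>))"
    using \<mu> \<epsilon> tendsto_minus[OF scaled_tail_tendsto_0[OF \<mu>]]
    by (intro nn_integral_FTC_atLeast DERIV_minus_scaled_tail avalanche_h_nonneg) auto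
  finally show ?thesis using scaled_tail_pos[OF \<mu> \<epsilon>] by simp
qed

lemma nn_integral_exp_Icc:
  assumes "0 \<le> lam" "0 \<le> x"
  shows "(\<integral>\<^sup>+s. ennreal (lam * exp (- lam * s)) * indicator {0..x} s \<partial>lborel) = ennreal (1 - exp (- lam * x))"
proof -
  have "(\<integral>\<^sup>+s. ennreal (lam * exp (- lam * s)) * indicator {0..x} s \<partial>lborel) = ennreal (- exp (- lam * x) - (- exp (- lam * 0)))"
    using assms by (intro nn_integral_FTC_Icc) (auto intro!: derivative_eq_intros)
  then show ?thesis by simp
qed

text \<open>The continuous counterpart of the summation by parts: write
  \<open>1 - exp (- lam * x)\<close> as the integral of \<open>lam * exp (- lam * s)\<close> over
  \<open>{0..x}\<close>, exchange the integrals, and evaluate the inner integral of \<open>h\<close>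
  over \<open>{s..\<epsilon>}\<close>.\<close>

lemma integral_avalanche_h_head:
  assumes \<mu>: "\<mu> > 0" and \<epsilon>: "\<epsilon> > 0" and lam: "lam \<ge> 0"
  shows "(LBINT x:{0<..<\<epsilon>}. (1 - exp (- lam * x)) * avalanche_h \<mu> x) =
    (\<integral>s. indicator {0<..<\<epsilon>} s * (lam * exp (- lam * s) * (scaled_tail \<mu> s - scaled_tail \<mu> \<epsilon>)) \<partial>lborel)"
proof -
  define \<phi> where "\<phi> = (\<lambda>s x. if 0 \<le> s \<and> s \<le> x \<and> 0 < x \<and> x < \<epsilon>
    then ennreal (lam * exp (- lam * s)) * ennreal (avalanche_h \<mu> x) else 0)"
  have [measurable]: "(\<lambda>(s, x). \<phi> s x) \<in> borel_measurable (lborel \<Otimes>\<^sub>M lborel)"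
    unfolding \<phi>_def by measurable
  have h: "0 \<le> avalanche_h \<mu> x" if "x > 0" for x by (rule avalanche_h_nonneg[OF \<mu> that])
  have le: "scaled_tail \<mu> \<epsilon> \<le> scaled_tail \<mu> s" if "0 < s" "s < \<epsilon>" for s
    using that \<mu> by (intro scaled_tail_antimono) auto
  have e1: "0 \<le> 1 - exp (- lam * x)" if "x > 0" for x using that lam by simp
  have x_int: "(\<integral>\<^sup>+s. \<phi> s x \<partial>lborel) = ennreal (indicator {0<..<\<epsilon>} x *\<^sub>R ((1 - exp (- lam * x)) * avalanche_h \<mu> x))" for x
  proof (cases "0 < x \<and> x < \<epsilon>")
    case True
    have "(\<integral>\<^sup>+s. \<phi> s x \<partial>lborel) = (\<integral>\<^sup>+s. ennreal (lam * exp (- lam * s)) * indicator {0..x} s * ennreal (avalanche_h \<mu> x) \<partial>lborel)"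
      using True by (intro nn_integral_cong) (auto simp: \<phi>_def indicator_def)
    also have "\<dots> = (\<integral>\<^sup>+s. ennreal (lam * exp (- lam * s)) * indicator {0..x} s \<partial>lborel) * ennreal (avalanche_h \<mu> x)"
      by (rule nn_integral_multc) measurable
    also have "(\<integral>\<^sup>+s. ennreal (lam * exp (- lam * s)) * indicator {0..x} s \<partial>lborel) = ennreal (1 - exp (- lam * x))"
      by (rule nn_integral_exp_Icc) (use True lam in auto)
    also have "ennreal (1 - exp (- lam * x)) * ennreal (avalanche_h \<mu> x) = ennreal ((1 - exp (- lam * x)) * avalanche_h \<mu> x)"
      using True h e1 by (intro ennreal_mult[symmetric]) auto
    finally show ?thesis using True by simp
  next
    case False
    then have "\<phi> s x = 0" for s by (auto simp: \<phi>_def)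
    then show ?thesis using False by (auto simp: indicator_def)
  qed
  \<comment> \<open>At \<open>s = 0\<close> the inner integral would run down to the singularity of
    \<open>h\<close>; this single point is a null set.\<close>
  have s_int: "(\<integral>\<^sup>+x. \<phi> s x \<partial>lborel) = ennreal (indicator {0<..<\<epsilon>} s * (lam * exp (- lam * s) * (scaled_tail \<mu> s - scaled_tail \<mu> \<epsilon>)))"
    if "s \<noteq> 0" for s
  proof (cases "0 < s \<and> s < \<epsilon>")
    case True
    have "(\<integral>\<^sup>+x. \<phi> s x \<partial>lborel) = (\<integral>\<^sup>+x. ennreal (lam * exp (- lam * s)) * (ennreal (avalanche_h \<mu> x) * indicator {s..\<epsilon>} x) \<partial>lborel)"
    proof (rule nn_integral_cong_AE)
      show "AE x in lborel. \<phi> s x = ennreal (lam * exp (- lam * s)) * (ennreal (avalanche_h \<mu> x) * indicator {s..\<epsilon>} x)"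
        using AE_lborel_singleton[of \<epsilon>] by eventually_elim (use True in \<open>auto simp: \<phi>_def indicator_def\<close>)
    qed
    also have "\<dots> = ennreal (lam * exp (- lam * s)) * (\<integral>\<^sup>+x. ennreal (avalanche_h \<mu> x) * indicator {s..\<epsilon>} x \<partial>lborel)"
      by (rule nn_integral_cmult) measurable
    also have "(\<integral>\<^sup>+x. ennreal (avalanche_h \<mu> x) * indicator {s..\<epsilon>} x \<partial>lborel) = ennreal (- scaled_tail \<mu> \<epsilon> - (- scaled_tail \<mu> s))"
      using True \<mu> by (intro nn_integral_FTC_Icc DERIV_minus_scaled_tail h) auto
    also have "ennreal (lam * exp (- lam * s)) * \<dots> = ennreal (lam * exp (- lam * s) * (- scaled_tail \<mu> \<epsilon> - (- scaled_tail \<mu> s)))"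
      using True lam le by (intro ennreal_mult[symmetric]) auto
    finally show ?thesis using True by simp
  next
    case False
    then have "\<phi> s x = 0" for x using that by (auto simp: \<phi>_def)
    then show ?thesis using False by (auto simp: indicator_def)
  qed
  have "(LBINT x:{0<..<\<epsilon>}. (1 - exp (- lam * x)) * avalanche_h \<mu> x) =
      enn2real (\<integral>\<^sup>+x. ennreal (indicator {0<..<\<epsilon>} x *\<^sub>R ((1 - exp (- lam * x)) * avalanche_h \<mu> x)) \<partial>lborel)"
    unfolding set_lebesgue_integral_def using h e1
    by (intro integral_eq_nn_integral) (auto simp: indicator_def)
  also have "(\<integral>\<^sup>+x. ennreal (indicator {0<..<\<epsilon>} x *\<^sub>R ((1 - exp (- lam * x)) * avalanche_h \<mu> x)) \<partial>lborel) =
      (\<integral>\<^sup>+x. \<integral>\<^sup>+s. \<phi> s x \<partial>lborel \<partial>lborel)"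
    by (simp only: x_int)
  also have "\<dots> = (\<integral>\<^sup>+s. \<integral>\<^sup>+x. \<phi> s x \<partial>lborel \<partial>lborel)"
    by (rule lborel_pair.Fubini') measurable
  also have "\<dots> = (\<integral>\<^sup>+s. ennreal (indicator {0<..<\<epsilon>} s * (lam * exp (- lam * s) * (scaled_tail \<mu> s - scaled_tail \<mu> \<epsilon>))) \<partial>lborel)"
  proof (rule nn_integral_cong_AE)
    show "AE s in lborel. (\<integral>\<^sup>+x. \<phi> s x \<partial>lborel) =
        ennreal (indicator {0<..<\<epsilon>} s * (lam * exp (- lam * s) * (scaled_tail \<mu> s - scaled_tail \<mu> \<epsilon>)))"
      using AE_lborel_singleton[of 0] by eventually_elim (rule s_int)
  qed
  also have "enn2real \<dots> = (\<integral>s. indicator {0<..<\<epsilon>} s * (lam * exp (- lam * s) * (scaled_tail \<mu> s - scaled_tail \<mu> \<epsilon>)) \<partial>lborel)"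
    using le lam by (intro integral_eq_nn_integral[symmetric]) (auto simp: indicator_def)
  finally show ?thesis .
qed

section \<open>Convergence of the Laplace transform\<close>

text \<open>Subtracting \<open>f w\<close> from the tail removes the boundary term at
  \<open>w\<close>; the one at 0 vanishes with \<open>1 - q ^ 0\<close>.\<close>

lemma abel_summation:
  fixes f :: "nat \<Rightarrow> real"
  shows "(\<Sum>i\<in>{1..w}. (1 - q ^ i) * (f (i - 1) - f i)) = (\<Sum>i<w. (q ^ i - q ^ Suc i) * (f i - f w))"
proof (induction w)
  case (Suc w)
  have "(\<Sum>i<Suc w. (q ^ i - q ^ Suc i) * (f i - f (Suc w))) =
    (\<Sum>i<w. (q ^ i - q ^ Suc i) * (f i - f w) + (q ^ i - q ^ Suc i) * (f w - f (Suc w))) + (q ^ w - q ^ Suc w) * (f w - f (Suc w))"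
    by (simp add: algebra_simps)
  also have "\<dots> = (\<Sum>i<w. (q ^ i - q ^ Suc i) * (f i - f w)) + (\<Sum>i<Suc w. q ^ i - q ^ Suc i) * (f w - f (Suc w))"
    by (simp add: sum.distrib sum_distrib_right distrib_right)
  also have "(\<Sum>i<Suc w. q ^ i - q ^ Suc i) = 1 - q ^ Suc w"
    by (subst sum_lessThan_telescope') simp
  finally show ?case using Suc by simp
qed simp

lemma has_bochner_integral_exp_Ico:
  fixes a b :: real
  assumes "a \<le> b"
  shows "has_bochner_integral lborel (\<lambda>s. lam * exp (- lam * s) * indicator {a..<b} s) (exp (- lam * a) - exp (- lam * b))"
proof -
  have "has_bochner_integral lborel (\<lambda>s. lam * exp (- lam * s) * indicator {a..b} s) (- exp (- lam * b) - (- exp (- lam * a)))"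
    using assms by (intro has_bochner_integral_FTC_Icc_real) (auto intro!: derivative_eq_intros continuous_intros)
  then have "has_bochner_integral lborel (\<lambda>s. lam * exp (- lam * s) * indicator {a..b} s) (exp (- lam * a) - exp (- lam * b))"
    by simp
  moreover have "AE s in lborel. lam * exp (- lam * s) * indicator {a..b} s = lam * exp (- lam * s) * indicator {a..<b} s"
    using AE_lborel_singleton[of b] by eventually_elim (auto simp: indicator_def)
  ultimately show ?thesis
    by (subst (asm) has_bochner_integral_cong_AE) auto
qed

text \<open>Writes the discrete sum exactly as an integral: \<open>q ^ i - q ^ Suc i\<close> is the
  integral of \<open>lam * exp (- lam * s)\<close> over the cell from \<open>i / n\<close> to
  \<open>(i + 1) / n\<close>, where \<open>q = exp (- lam / n)\<close>.\<close>

definition step_density :: "real \<Rightarrow> nat \<Rightarrow> nat \<Rightarrow> (nat \<Rightarrow> real) \<Rightarrow> real \<Rightarrow> real" where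
  "step_density lam n w f s =
    (\<Sum>i<w. (f i - f w) * (lam * exp (- lam * s) * indicator {real i / real n..<real (Suc i) / real n} s))"

lemma integral_step_density:
  assumes n: "n > 0"
  shows "has_bochner_integral lborel (step_density lam n w f)
    (\<Sum>i\<in>{1..w}. (1 - exp (- (lam / real n)) ^ i) * (f (i - 1) - f i))"
proof -
  define q where "q = exp (- (lam / real n))"
  have q: "exp (- lam * (real i / real n)) = q ^ i" for i
    by (simp add: q_def exp_of_nat_mult[symmetric] mult.commute)
  have "has_bochner_integral lborel (step_density lam n w f)
    (\<Sum>i<w. (f i - f w) * (exp (- lam * (real i / real n)) - exp (- lam * (real (Suc i) / real n))))"
    unfolding step_density_def
    by (intro has_bochner_integral_sum has_bochner_integral_mult_right has_bochner_integral_exp_Ico divide_right_mono) auto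
  then show ?thesis
    unfolding q abel_summation q_def[symmetric] by (simp only: mult.commute)
qed

lemma step_density_eq:
  assumes n: "n > 0"
  shows "step_density lam n w f s = (if 0 \<le> s \<and> horizon s n < w
    then (f (horizon s n) - f w) * (lam * exp (- lam * s)) else 0)"
proof -
  have ind: "indicator {real i / real n..<real (Suc i) / real n} s = (if 0 \<le> s \<and> i = horizon s n then 1 else (0::real))" for i
  proof -
    have "s \<in> {real i / real n..<real (Suc i) / real n} \<longleftrightarrow> real i \<le> s * real n \<and> s * real n < real i + 1"
      using n by (simp add: field_simps)
    also have "\<dots> \<longleftrightarrow> \<lfloor>s * real n\<rfloor> = int i" by (simp add: floor_eq_iff)
    also have "\<dots> \<longleftrightarrow> 0 \<le> s \<and> i = horizon s n"
    proof (cases "0 \<le> s")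
      case False
      then have "s * real n < 0" using n by (simp add: mult_neg_pos)
      then show ?thesis using False by linarith
    next
      case True
      then have "0 \<le> \<lfloor>s * real n\<rfloor>" by simp
      then show ?thesis using True by auto
    qed
    finally show ?thesis by (simp add: indicator_def)
  qed
  show ?thesis
  proof (cases "0 \<le> s")
    case True
    have "step_density lam n w f s = (\<Sum>i<w. if i = horizon s n then (f i - f w) * (lam * exp (- lam * s)) else 0)"
      unfolding step_density_def ind using True by (intro sum.cong) auto
    then show ?thesis using True by simp
  next
    case False
    then show ?thesis unfolding step_density_def ind by simp
  qed
qed

lemma integrable_inverse_sqrt:
  assumes "\<epsilon> > 0" shows "integrable lborel (\<lambda>s::real. indicator {0<..<\<epsilon>} s * (lam / sqrt s))"
proof -
  have "set_integrable lborel (einterval (ereal 0) (ereal \<epsilon>)) (\<lambda>s. inverse (sqrt s))"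
  proof (rule interval_integral_FTC_nonneg(1))
    show "((\<lambda>s. 2 * sqrt s) has_real_derivative inverse (sqrt x)) (at x)" if "ereal 0 < ereal x" "ereal x < ereal \<epsilon>" for x
      using that by (auto intro!: derivative_eq_intros)
    show "isCont (\<lambda>s. inverse (sqrt s)) x" if "ereal 0 < ereal x" "ereal x < ereal \<epsilon>" for x
      using that by (auto intro!: continuous_intros)
    have "((\<lambda>s. 2 * sqrt s) \<longlongrightarrow> 2 * sqrt 0) (at_right 0)" by (intro tendsto_intros)
    then show "(((\<lambda>s. 2 * sqrt s) \<circ> real_of_ereal) \<longlongrightarrow> 0) (at_right (ereal 0))"
      by (simp add: ereal_tendsto_simps1)
    have "((\<lambda>s. 2 * sqrt s) \<longlongrightarrow> 2 * sqrt \<epsilon>) (at_left \<epsilon>)" by (intro tendsto_intros)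
    then show "(((\<lambda>s. 2 * sqrt s) \<circ> real_of_ereal) \<longlongrightarrow> 2 * sqrt \<epsilon>) (at_left (ereal \<epsilon>))"
      by (simp add: ereal_tendsto_simps1)
  qed (use assms in auto)
  then have "integrable lborel (\<lambda>s. lam * (indicator {0<..<\<epsilon>} s * inverse (sqrt s)))"
    unfolding set_integrable_def by simp
  then show ?thesis by (simp add: divide_inverse mult_ac)
qed

lemma scaled_loss_tendsto:
  assumes \<mu>: "\<mu> > 0" and \<epsilon>: "\<epsilon> > 0" and lam: "lam \<ge> 0"
  shows "(\<lambda>n. sqrt (real n) * (\<Sum>i\<in>{1..horizon \<epsilon> n}. (1 - exp (- (lam / real n)) ^ i) *
      (tail_prob (spread \<mu> n) (i - 1) - tail_prob (spread \<mu> n) i)))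
    \<longlonglongrightarrow> (LBINT x:{0<..<\<epsilon>}. (1 - exp (- lam * x)) * avalanche_h \<mu> x)"
proof -
  define g where "g = (\<lambda>n s. sqrt (real n) * step_density lam n (horizon \<epsilon> n) (tail_prob (spread \<mu> n)) s)"
  define G where "G = (\<lambda>s. indicator {0<..<\<epsilon>} s * (lam * exp (- lam * s) * (scaled_tail \<mu> s - scaled_tail \<mu> \<epsilon>)))"
  obtain n0 where n0: "\<And>n. n \<ge> n0 \<Longrightarrow> n > 0 \<and> spread \<mu> n \<ge> 1"
    using eventually_conj[OF eventually_gt_at_top[of "0::nat"] eventually_spread[OF \<mu>]]
    unfolding eventually_sequentially by auto
  have g_int: "(\<integral>s. g n s \<partial>lborel) = sqrt (real n) * (\<Sum>i\<in>{1..horizon \<epsilon> n}. (1 - exp (- (lam / real n)) ^ i) *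
      (tail_prob (spread \<mu> n) (i - 1) - tail_prob (spread \<mu> n) i))" if "n \<ge> n0" for n
    unfolding g_def using n0[OF that] integral_step_density[of n lam "horizon \<epsilon> n" "tail_prob (spread \<mu> n)"]
    by (simp add: has_bochner_integral_iff)
  have g_eq: "g n s = (if 0 \<le> s \<and> horizon s n < horizon \<epsilon> n then lam * exp (- lam * s) *
      (sqrt (real n) * tail_prob (spread \<mu> n) (horizon s n) - sqrt (real n) * tail_prob (spread \<mu> n) (horizon \<epsilon> n)) else 0)"
    if "n > 0" for n s
    unfolding g_def step_density_eq[OF that] by (simp add: algebra_simps)
  have lim: "(\<lambda>n. g n s) \<longlonglongrightarrow> G s" if s: "s \<noteq> 0" "s \<noteq> \<epsilon>" for s
  proof (cases "0 < s \<and> s < \<epsilon>")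
    case True
    have "(\<lambda>n. lam * exp (- lam * s) *
      (sqrt (real n) * tail_prob (spread \<mu> n) (horizon s n) - sqrt (real n) * tail_prob (spread \<mu> n) (horizon \<epsilon> n)))
      \<longlonglongrightarrow> lam * exp (- lam * s) * (scaled_tail \<mu> s - scaled_tail \<mu> \<epsilon>)"
      using True by (intro tendsto_mult tendsto_const tendsto_diff tail_prob_tendsto \<mu> \<epsilon>) simp
    moreover have "\<forall>\<^sub>F n in sequentially. lam * exp (- lam * s) *
      (sqrt (real n) * tail_prob (spread \<mu> n) (horizon s n) - sqrt (real n) * tail_prob (spread \<mu> n) (horizon \<epsilon> n)) = g n s"
    proof -
      \<comment> \<open>Once \<open>s * n\<close> and \<open>\<epsilon> * n\<close> are at least 1
        apart their floors differ, so \<open>s\<close> lies in the support of the step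
        function.\<close>
      have "filterlim (\<lambda>n. (\<epsilon> - s) * real n) at_top sequentially"
        using True by (intro filterlim_tendsto_pos_mult_at_top[OF tendsto_const] filterlim_real_sequentially) simp
      then have "\<forall>\<^sub>F n in sequentially. 1 \<le> (\<epsilon> - s) * real n"
        by (rule eventually_compose_filterlim[OF eventually_ge_at_top])
      then show ?thesis using eventually_gt_at_top[of "0::nat"]
      proof eventually_elim
        case (elim n)
        have "0 \<le> s * real n" using True by simp
        moreover have "s * real n + 1 \<le> \<epsilon> * real n" using elim by (simp add: algebra_simps)
        ultimately have "horizon s n < horizon \<epsilon> n" by linarith
        then show ?case using True elim by (simp add: g_eq)
      qed
    qed
    ultimately have "(\<lambda>n. g n s) \<longlonglongrightarrow> lam * exp (- lam * s) * (scaled_tail \<mu> s - scaled_tail \<mu> \<epsilon>)"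
      by (rule Lim_transform_eventually)
    then show ?thesis using True by (simp add: G_def)
  next
    case False
    have outside: "\<not> (0 \<le> s \<and> horizon s n < horizon \<epsilon> n)" for n
    proof
      assume *: "0 \<le> s \<and> horizon s n < horizon \<epsilon> n"
      then have "\<epsilon> \<le> s" using False s by auto
      then have "horizon \<epsilon> n \<le> horizon s n" by (intro nat_mono floor_mono mult_right_mono) auto
      with * show False by linarith
    qed
    have "\<forall>\<^sub>F n in sequentially. g n s = 0"
      using eventually_gt_at_top[of "0::nat"] by eventually_elim (simp only: g_eq outside if_False)
    then have "(\<lambda>n. g n s) \<longlonglongrightarrow> 0" by (rule tendsto_eventually)
    then show ?thesis using False by (simp add: G_def)
  qed
  \<comment> \<open>The point 0 is excluded because the tail there is \<open>f 0 = 1\<close>, and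
    nothing compensates the factor \<open>sqrt n\<close>.\<close>
  have bound: "norm (g n s) \<le> indicator {0<..<\<epsilon>} s * (lam / sqrt s)" if n: "n \<ge> n0" and s: "s \<noteq> 0" for n s
  proof (cases "0 \<le> s \<and> horizon s n < horizon \<epsilon> n")
    case True
    have npos: "n > 0" and m: "spread \<mu> n \<ge> 1" using n0[OF n] by auto
    have s_pos: "s > 0" using True s by simp
    have "s < \<epsilon>"
    proof (rule ccontr)
      assume "\<not> s < \<epsilon>"
      then have "horizon \<epsilon> n \<le> horizon s n" by (intro nat_mono floor_mono mult_right_mono) auto
      with True show False by linarith
    qed
    define A B where "A = sqrt (real n) * tail_prob (spread \<mu> n) (horizon s n)"
      and "B = sqrt (real n) * tail_prob (spread \<mu> n) (horizon \<epsilon> n)"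
    have "A \<le> 1 / sqrt s" unfolding A_def using m s_pos npos by (rule tail_prob_le)
    moreover have "0 \<le> B" unfolding B_def using tail_prob_pos[OF m] by (simp add: less_imp_le)
    moreover have "B \<le> A" unfolding A_def B_def using True m by (intro mult_left_mono tail_prob_antimono) auto
    ultimately have AB: "0 \<le> A - B" "A - B \<le> 1 / sqrt s" by linarith+
    have "norm (g n s) = lam * exp (- lam * s) * (A - B)"
      unfolding g_eq[OF npos] A_def[symmetric] B_def[symmetric] using True lam AB by (simp add: abs_mult)
    also have "\<dots> \<le> (lam * 1) * (1 / sqrt s)"
      using lam s_pos AB by (intro mult_mono mult_left_mono) auto
    finally show ?thesis using s_pos \<open>s < \<epsilon>\<close> by simp
  next
    case False
    then have "g n s = 0" using n0[OF n] by (auto simp: g_eq)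
    then show ?thesis using lam by (auto simp: indicator_def)
  qed
  have [measurable]: "g n \<in> borel_measurable borel" for n
    unfolding g_def step_density_def by measurable
  have [measurable]: "G \<in> borel_measurable borel" unfolding G_def by measurable
  have "(\<lambda>n. \<integral>s. g (n + n0) s \<partial>lborel) \<longlonglongrightarrow> (\<integral>s. G s \<partial>lborel)"
  proof (rule integral_dominated_convergence[where w = "\<lambda>s. indicator {0<..<\<epsilon>} s * (lam / sqrt s)"])
    show "integrable lborel (\<lambda>s. indicator {0<..<\<epsilon>} s * (lam / sqrt s))" by (rule integrable_inverse_sqrt[OF \<epsilon>])
    show "AE s in lborel. (\<lambda>n. g (n + n0) s) \<longlonglongrightarrow> G s"
      using AE_lborel_singleton[of 0] AE_lborel_singleton[of \<epsilon>]
      by eventually_elim (intro LIMSEQ_ignore_initial_segment lim)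
    show "AE s in lborel. norm (g (n + n0) s) \<le> indicator {0<..<\<epsilon>} s * (lam / sqrt s)" for n
      using AE_lborel_singleton[of 0] by eventually_elim (intro bound, auto)
  qed measurable
  then have "(\<lambda>n. sqrt (real (n + n0)) * (\<Sum>i\<in>{1..horizon \<epsilon> (n + n0)}. (1 - exp (- (lam / real (n + n0))) ^ i) *
      (tail_prob (spread \<mu> (n + n0)) (i - 1) - tail_prob (spread \<mu> (n + n0)) i))) \<longlonglongrightarrow> (\<integral>s. G s \<partial>lborel)"
    by (subst (asm) g_int) simp_all
  then show ?thesis
    unfolding integral_avalanche_h_head[OF \<mu> \<epsilon> lam] G_def[symmetric] by (rule LIMSEQ_offset)
qed

theorem theorem3:
  fixes M :: "'a measure" and S :: "nat \<Rightarrow> 'a \<Rightarrow> int" and \<mu> \<epsilon> lam :: real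
  assumes "simple_symmetric_random_walk M S"
    and "\<mu> > 0" and "\<epsilon> > 0" and "lam \<ge> 0"
  shows "(\<lambda>n :: nat. \<integral>\<omega>. exp (- (lam / real n) *
             real (full_avalanche_length (nat \<lfloor>\<mu> * sqrt (real n)\<rfloor>) (nat \<lfloor>\<epsilon> * real n\<rfloor>)
               (\<lambda>i. S i \<omega>))) \<partial>M)
         \<longlonglongrightarrow> (LBINT x:{\<epsilon><..}. avalanche_h \<mu> x) /
             ((LBINT x:{0<..<\<epsilon>}. (1 - exp (- lam * x)) * avalanche_h \<mu> x) + (LBINT x:{\<epsilon><..}. avalanche_h \<mu> x))"
proof -
  interpret simple_symmetric_random_walk M S by fact
  note \<mu> = \<open>\<mu> > 0\<close> and \<epsilon> = \<open>\<epsilon> > 0\<close> and lam = \<open>lam \<ge> 0\<close>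
  define J where "J = (LBINT x:{0<..<\<epsilon>}. (1 - exp (- lam * x)) * avalanche_h \<mu> x)"
  define D where "D = (\<lambda>n. \<Sum>i\<in>{1..horizon \<epsilon> n}. (1 - exp (- (lam / real n)) ^ i) *
      (tail_prob (spread \<mu> n) (i - 1) - tail_prob (spread \<mu> n) i))"
  define f where "f = (\<lambda>n. tail_prob (spread \<mu> n) (horizon \<epsilon> n))"
  have f: "(\<lambda>n. sqrt (real n) * f n) \<longlonglongrightarrow> scaled_tail \<mu> \<epsilon>"
    unfolding f_def by (rule tail_prob_tendsto[OF \<mu> \<epsilon>])
  have D: "(\<lambda>n. sqrt (real n) * D n) \<longlonglongrightarrow> J"
    unfolding D_def J_def by (rule scaled_loss_tendsto[OF \<mu> \<epsilon> lam])
  have J: "0 \<le> J"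
    unfolding J_def set_lebesgue_integral_def using avalanche_h_nonneg[OF \<mu>] lam
    by (intro Bochner_Integration.integral_nonneg) (auto simp: indicator_def)
  \<comment> \<open>With \<open>J >= 0\<close> this makes the limiting denominator positive; for
    \<open>lam = 0\<close>, where \<open>J\<close> vanishes, it is the whole denominator.\<close>
  have pos: "0 < scaled_tail \<mu> \<epsilon>" by (rule scaled_tail_pos[OF \<mu> \<epsilon>])
  have "(\<lambda>n. (sqrt (real n) * f n) / (sqrt (real n) * D n + sqrt (real n) * f n)) \<longlonglongrightarrow>
      scaled_tail \<mu> \<epsilon> / (J + scaled_tail \<mu> \<epsilon>)"
    using J pos by (intro tendsto_divide tendsto_add f D) auto
  moreover have "\<forall>\<^sub>F n in sequentially. (sqrt (real n) * f n) / (sqrt (real n) * D n + sqrt (real n) * f n) =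
      (\<integral>\<omega>. exp (- (lam / real n) * real (full_avalanche_length (spread \<mu> n) (horizon \<epsilon> n) (\<lambda>i. S i \<omega>))) \<partial>M)"
    using eventually_gt_at_top[of "0::nat"] eventually_spread[OF \<mu>]
  proof eventually_elim
    case (elim n)
    define q where "q = exp (- (lam / real n))"
    define p where "p = (\<lambda>i. tail_prob (spread \<mu> n) (i - 1) - tail_prob (spread \<mu> n) i)"
    \<comment> \<open>The mass of the intertrading time up to the window turns the renewal
      denominator into the loss \<open>D n\<close> plus the tail \<open>f n\<close>, both of order
      \<open>1 / sqrt n\<close>.\<close>
    have "(\<Sum>i\<in>{1..horizon \<epsilon> n}. p i) = 1 - f n"
      unfolding p_def f_def by (rule sum_tail_prob[OF elim(2)])
    moreover have "D n = (\<Sum>i\<in>{1..horizon \<epsilon> n}. p i) - (\<Sum>i\<in>{1..horizon \<epsilon> n}. q ^ i * p i)"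
    proof -
      have "D n = (\<Sum>i\<in>{1..horizon \<epsilon> n}. (1 - q ^ i) * p i)" by (simp only: D_def q_def p_def)
      then show ?thesis by (simp only: left_diff_distrib sum_subtractf mult_1)
    qed
    ultimately have eq: "D n + f n = 1 - (\<Sum>i\<in>{1..horizon \<epsilon> n}. q ^ i * p i)" by simp
    have "(sqrt (real n) * f n) / (sqrt (real n) * D n + sqrt (real n) * f n) = f n / (D n + f n)"
      using elim by (simp add: distrib_left[symmetric])
    also have "\<dots> = f n / (1 - (\<Sum>i\<in>{1..horizon \<epsilon> n}. q ^ i * p i))" by (simp only: eq)
    also have "\<dots> = (\<integral>\<omega>. exp (- (lam / real n) * real (full_avalanche_length (spread \<mu> n) (horizon \<epsilon> n) (\<lambda>i. S i \<omega>))) \<partial>M)"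
      unfolding q_def p_def f_def using elim(2) lam by (intro laplace_full_avalanche_length[symmetric]) auto
    finally show ?case .
  qed
  ultimately show ?thesis
    unfolding integral_avalanche_h_tail[OF \<mu> \<epsilon>] J_def by (rule Lim_transform_eventually)
qed

end
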